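(* Let $a_\pm:\mathbb R\to\mathbb R$ be $C^1$-functions with bounded derivatives such that $0<\inf_{\mathbb R}a_\pm$, $\sup_{\mathbb R}a_\pm<1$ and $$0<a_+(y)<\sup\{a_+(y):y\in\mathbb R\}\le\tfrac12\le\inf\{a_-(y):y\in\mathbb R\}<a_-(y)<1,$$ and let $0<c<1$ be a fixed number. Consider the equation $$\ddot u+u\,(u-a_-(\varepsilon t+\bar y))(1-u)=0\ \text{ if } u<c,\qquad \ddot u+u\,(u-a_+(\varepsilon t+\bar y))(1-u)=0\ \text{ if }u>c. \qquad( * )$$ Then equation $( * )$ with $\varepsilon=0$ (and $\bar y=y$) has a family of $C^1$-solutions $u_-(t,y)$, defined for $t\le0$, and $u_+(t,y)$, defined for $t\ge0$, bounded together with their derivatives, such that $u_-(0,y)=u_+(0,y)=c$ and $$\lim_{t\to-\infty}u_-(t,y)=0,\qquad\lim_{t\to\infty}u_+(t,y)=1$$ uniformly with respect to $y$. Next, let $D(y)=c^2(2c-3)[a_+(y)-a_-(y)]+a_+(y)-\frac12$ and suppose that $y_0\in\mathbb R$ and $0<c<1$ exist such that $$D(y_0)=0,\qquad D'(y_0)\neq0 .$$ Then $\dot u_-(0,y_0)=\dot u_+(0,y_0)$ and there exists $\varepsilon_0>0$ such that for $0<\varepsilon<\varepsilon_0$ there exist a $C^1$-function $y_0(\varepsilon)$ with $\lim_{\varepsilon\to0}y_0(\varepsilon)=y_0$, and a $C^1$-solution $u(t,\varepsilon)$, $t\in\mathbb R$, of equation $( * )$ with $\bar y=y_0(\varepsilon)$,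 bounded with its derivatives and such that $$\lim_{\varepsilon\to0}\sup_{t\in\mathbb R_\pm}|u(t,\varepsilon)-u_\pm(t,\varepsilon t+y_0(\varepsilon))|=0,\qquad \lim_{\varepsilon\to0}\sup_{t\in\mathbb R_\pm}|\dot u(t,\varepsilon)-\dot u_\pm(t,\varepsilon t+y_0(\varepsilon))|=0 .$$
   Context: $\mathbb R_+=[0,\infty)$, $\mathbb R_-=(-\infty,0]$; formulas with $\pm$ are read with upper signs together and lower signs together ($u_+$ on $\mathbb R_+$, $u_-$ on $\mathbb R_-$). A dot denotes $d/dt$. A $C^1$-solution of the discontinuous equation $( * )$ is a $C^1$ function of $t$ satisfying the relevant second-order equation at every $t$ with $u(t)<c$, respectively $u(t)>c$. In the equation with $\varepsilon=0$ the number $y=\bar y$ is a constant parameter. *)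

theory Defs
  imports "HOL-Analysis.Analysis"
begin

definition dot :: "real set \<Rightarrow> (real \<Rightarrow> real) \<Rightarrow> real \<Rightarrow> real" where
  "dot S u t = vector_derivative u (at t within S)"

text \<open>C1-solutions, on a time interval S, of
  \<open>u'' + u (u - am (\<epsilon> t + y)) (1 - u) = 0\<close> if \<open>u < c\<close> and
  \<open>u'' + u (u - ap (\<epsilon> t + y)) (1 - u) = 0\<close> if \<open>u > c\<close>.
  At an endpoint of S the derivatives are one-sided; where \<open>u = c\<close> no equation is imposed and
  only the C1 condition remains.\<close>

definition C1_solution ::
  "real \<Rightarrow> (real \<Rightarrow> real) \<Rightarrow> (real \<Rightarrow> real) \<Rightarrow> real \<Rightarrow> real \<Rightarrow> real set \<Rightarrow> (real \<Rightarrow> real) \<Rightarrow> bool" where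
  "C1_solution c am ap \<epsilon> y S u \<longleftrightarrow>
     u differentiable_on S \<and> continuous_on S (dot S u) \<and>
     (\<forall>t\<in>S. u t < c \<longrightarrow>
        (dot S u has_real_derivative - (u t * (u t - am (\<epsilon> * t + y)) * (1 - u t))) (at t within S)) \<and>
     (\<forall>t\<in>S. u t > c \<longrightarrow>
        (dot S u has_real_derivative - (u t * (u t - ap (\<epsilon> * t + y)) * (1 - u t))) (at t within S))"

text \<open>Boundedness of a family \<open>u t p\<close> (time t in S, parameter p in P) together with its time
  derivatives, uniformly in p. The second derivative is only considered where the equation
  determines it, since it may fail to exist where \<open>u = c\<close>.\<close>

definition bounded_with_derivs ::
  "real \<Rightarrow> real set \<Rightarrow> real set \<Rightarrow> (real \<Rightarrow> real \<Rightarrow> real) \<Rightarrow> bool" where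
  "bounded_with_derivs c S P u \<longleftrightarrow>
     (\<exists>B. \<forall>p\<in>P. \<forall>t\<in>S.
        \<bar>u t p\<bar> \<le> B \<and>
        \<bar>dot S (\<lambda>s. u s p) t\<bar> \<le> B \<and>
        (u t p \<noteq> c \<longrightarrow> \<bar>dot S (dot S (\<lambda>s. u s p)) t\<bar> \<le> B))"

definition D_fun :: "real \<Rightarrow> (real \<Rightarrow> real) \<Rightarrow> (real \<Rightarrow> real) \<Rightarrow> real \<Rightarrow> real" where
  "D_fun c am ap y = c^2 * (2 * c - 3) * (ap y - am y) + ap y - 1/2"

end

theory Submission
  imports Defs
begin

text \<open>
The equation is solved separately on the two half lines and the two halves are glued at \<open>t = 0\<close>,
where \<open>u = c\<close>. Reversing time on the left half line, and replacing \<open>u\<close> by \<open>1 - u\<close> and \<open>ap\<close> by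
\<open>1 - ap\<close> on the right one, both halves become the same problem: for \<open>1/2 \<le> a \<le> 1\<close> find the
solution of \<open>v'' = - v (v - a (y + \<epsilon> s)) (1 - v)\<close>, \<open>s \<ge> 0\<close>, with a given value \<open>v(0) = c\<close> in \<open>(0, 1)\<close> that
decays to \<open>0\<close>; on the right half line \<open>1 - c\<close> takes the place of \<open>c\<close>.

Such a solution decreases, so \<open>x = - ln (v / c)\<close> can replace time as the independent variable. The
unknown is then the time \<open>T(x)\<close> elapsed until \<open>v\<close> has dropped to \<open>c exp (- x)\<close>. Integrating the energy
\<open>v'^2 / 2\<close> from \<open>v = 0\<close> upwards expresses \<open>v'\<close> at \<open>x\<close> by the values of \<open>a (y + \<epsilon> T)\<close> on \<open>[x, \<infinity>)\<close>, and
\<open>T\<close> solves an integral equation. Since \<open>a \<ge> 1/2\<close>, the energy is at least \<open>v^2 (1 - v)^2 / 4\<close> whatever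
the unknown \<open>T\<close> is; hence the right-hand side of this equation is a globally defined contraction
for small \<open>\<epsilon>\<close>, in a sup norm with an exponential weight. This is where uniformity in \<open>y\<close> comes from.
The parameters \<open>(\<epsilon>, y)\<close> are treated as further arguments of the unknown, so that joint continuity in all
arguments is part of the fixed point theorem (\<open>fixed_point_exists\<close>).

Differentiability in the parameters is obtained without differentiating. For two parameter
values the difference of the elapsed times solves a linear equation of the same kind, whose
coefficients are difference quotients of \<open>a\<close>, continuous in the pair of parameters. Its solution
depends linearly on the increments of \<open>y\<close> and \<open>\<epsilon>\<close>, so that the squared initial speed \<open>v'(0)^2\<close> has
increments \<open>\<alpha> \<Delta>y + \<beta> \<Delta>\<epsilon>\<close> with \<open>\<alpha>\<close> and \<open>\<beta>\<close> continuous in the pair (\<open>potential_chords\<close>): this is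
Caratheodory's form of continuous differentiability. The same form turns the intermediate value
theorem into an implicit function theorem with a continuously differentiable solution
(\<open>chord_implicit_function\<close>).

At \<open>\<epsilon> = 0\<close> the difference of the squared slopes of the two halves at \<open>t = 0\<close> is \<open>- D(y) / 3\<close>
(\<open>gap_at_eps_0\<close>). A simple zero \<open>y0\<close> of \<open>D\<close> therefore continues to a curve of parameters along which the
slopes agree and the halves fit together to a \<open>C1\<close> solution. Finally, that solution is
close to the slowly modulated profiles of \<open>\<epsilon> = 0\<close> because both decay at a rate independent of the
parameters, while on bounded time intervals they are close by joint continuity (\<open>slow_modulation\<close>).
\<close>

section \<open>Integrals whose domain and integrand depend on parameters\<close>

definition jointly_continuous :: "('p::metric_space \<Rightarrow> real \<Rightarrow> real) \<Rightarrow> bool" where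
  "jointly_continuous \<phi> \<longleftrightarrow> continuous_on UNIV (\<lambda>z. \<phi> (fst z) (snd z))"

lemma jointly_continuous_compose:
  assumes "jointly_continuous \<phi>" "continuous_on S f" "continuous_on S g"
  shows "continuous_on S (\<lambda>x. \<phi> (f x) (g x))"
proof -
  have "continuous_on S (\<lambda>x. (f x, g x))"
    using assms by (intro continuous_intros)
  from continuous_on_compose2[OF assms(1)[unfolded jointly_continuous_def] this]
  show ?thesis by simp
qed

lemma jointly_continuousI:
  assumes "continuous_on UNIV (\<lambda>z. \<phi> (fst z) (snd z))"
  shows "jointly_continuous \<phi>"
  using assms by (simp add: jointly_continuous_def)

text \<open>The exponent of the weight is \<open>1 / 2\<close> because it has to be positive and less than \<open>1\<close>: a positive
exponent makes integration over \<open>[0, x]\<close> bounded in the weighted norm, and an exponent below \<open>1\<close> makes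
the kernel of \<open>tail_mean\<close> below continuous at its endpoint.\<close>

definition exp_half_growth :: "real \<Rightarrow> (real \<Rightarrow> real) \<Rightarrow> bool" where
  "exp_half_growth D \<phi> \<longleftrightarrow> (\<forall>\<xi>. \<bar>\<phi> \<xi>\<bar> \<le> D * exp (\<bar>\<xi>\<bar> / 2))"

lemma exp_half_growthD: "exp_half_growth D \<phi> \<Longrightarrow> \<bar>\<phi> \<xi>\<bar> \<le> D * exp (\<bar>\<xi>\<bar> / 2)"
  by (simp add: exp_half_growth_def)

lemma exp_half_growth_nonneg: "exp_half_growth D \<phi> \<Longrightarrow> 0 \<le> D"
  using exp_half_growthD[of D \<phi> 0] by simp

lemma exp_half_growthI_bounded:
  assumes "\<And>\<xi>. \<bar>\<phi> \<xi>\<bar> \<le> B"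
  shows "exp_half_growth B \<phi>"
  unfolding exp_half_growth_def
proof
  fix \<xi>
  have "0 \<le> B" using assms[of 0] by simp
  then have "B * 1 \<le> B * exp (\<bar>\<xi>\<bar> / 2)" by (intro mult_left_mono) auto
  then show "\<bar>\<phi> \<xi>\<bar> \<le> B * exp (\<bar>\<xi>\<bar> / 2)" using assms[of \<xi>] by simp
qed

lemma exp_half_growth_linear:
  assumes "exp_half_growth B f" "exp_half_growth C s"
  shows "exp_half_growth (\<bar>u\<bar> * B + \<bar>v\<bar> * C) (\<lambda>\<eta>. u * f \<eta> + v * s \<eta>)"
  unfolding exp_half_growth_def
proof
  fix \<xi>
  have "\<bar>u * f \<xi> + v * s \<xi>\<bar> \<le> \<bar>u\<bar> * \<bar>f \<xi>\<bar> + \<bar>v\<bar> * \<bar>s \<xi>\<bar>"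
    using abs_triangle_ineq[of "u * f \<xi>" "v * s \<xi>"] by (simp add: abs_mult)
  also have "\<dots> \<le> \<bar>u\<bar> * (B * exp (\<bar>\<xi>\<bar> / 2)) + \<bar>v\<bar> * (C * exp (\<bar>\<xi>\<bar> / 2))"
    by (intro add_mono mult_left_mono exp_half_growthD assms) auto
  finally show "\<bar>u * f \<xi> + v * s \<xi>\<bar> \<le> (\<bar>u\<bar> * B + \<bar>v\<bar> * C) * exp (\<bar>\<xi>\<bar> / 2)"
    by (simp add: algebra_simps)
qed

lemma integral_upto_rescale:
  fixes k :: "real \<Rightarrow> real"
  assumes "0 \<le> z" "continuous_on {0..z} k"
  shows "integral {0..z} k = z * integral {0..1} (\<lambda>s. k (z * s))"
proof (cases "z = 0")
  case False
  then have z: "z > 0" using assms by simp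
  have "integral ((\<lambda>x. x / z) ` {0..z}) (\<lambda>x. k (z * x)) = (1 / \<bar>z\<bar>) *\<^sub>R integral {0..z} k"
    by (rule integral_stretch_real) (use z integrable_continuous_interval[OF assms(2)] in auto)
  moreover have "(\<lambda>x. x / z) ` {0..z} = {0..1}"
  proof -
    have "x \<in> (\<lambda>x. x / z) ` {0..z}" if "0 \<le> x" "x \<le> 1" for x
      using that z by (intro image_eqI[of _ _ "z * x"]) (auto simp: mult_le_cancel_left1)
    then show ?thesis using z by (auto simp: divide_simps)
  qed
  ultimately show ?thesis using z by (simp add: field_simps)
qed simp

text \<open>Rescaling the domain to the fixed interval \<open>[0, 1]\<close> moves the dependence on the upper limit into the
integrand.\<close>

lemma continuous_integral_upto:
  fixes k :: "'p::metric_space \<Rightarrow> real \<Rightarrow> real"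
  assumes k: "continuous_on (UNIV \<times> {0..}) (\<lambda>z. k (fst z) (snd z))"
  shows "continuous_on (UNIV \<times> {0..}) (\<lambda>z. integral {0..snd z} (k (fst z)))"
proof -
  have "continuous_on ((UNIV \<times> {0..}) \<times> cbox 0 1)
      (\<lambda>w. k (fst (fst w)) (snd (fst w) * snd w))"
    by (rule continuous_on_compose2[OF k, of _ "\<lambda>w. (fst (fst w), snd (fst w) * snd w)", simplified])
      (auto intro!: continuous_intros)
  then have "continuous_on ((UNIV \<times> {0..}) \<times> cbox 0 1)
      (\<lambda>(z, s). k (fst z) (snd z * s))"
    by (simp add: case_prod_unfold)
  from integral_continuous_on_param[OF this]
  have "continuous_on (UNIV \<times> {0..}) (\<lambda>z. snd z * integral (cbox 0 1) (\<lambda>s. k (fst z) (snd z * s)))"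
    by (intro continuous_intros)
  moreover have "integral {0..snd z} (k (fst z)) = snd z * integral (cbox 0 1) (\<lambda>s. k (fst z) (snd z * s))"
    if "z \<in> UNIV \<times> {0..}" for z
  proof -
    have "continuous_on {0..snd z} (k (fst z))"
      by (rule continuous_on_compose2[OF k, of _ "\<lambda>r. (fst z, r)", simplified])
        (auto intro!: continuous_intros)
    with that show ?thesis by (auto intro!: integral_upto_rescale)
  qed
  ultimately show ?thesis
    by (simp cong: continuous_on_cong)
qed

text \<open>In the variable \<open>r = exp (- \<xi>)\<close>, \<open>tail_mean c \<phi> x\<close> is the integral of
\<open>\<phi> \<xi> (1 - c exp (- \<xi>)) exp (- 2 (\<xi> - x))\<close> over \<open>\<xi> \<ge> x\<close>. The substitution makes the domain compact, with
\<open>r = 0\<close> in place of \<open>\<xi> = \<infinity>\<close>. There the kernel vanishes, which is its limit if \<open>\<phi>\<close> grows at most like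
\<open>exp (\<xi> / 2)\<close>.\<close>

definition tail_kernel :: "real \<Rightarrow> (real \<Rightarrow> real) \<Rightarrow> real \<Rightarrow> real" where
  "tail_kernel c \<phi> r = \<phi> (- ln r) * (r - c * r\<^sup>2)"

definition tail_mean :: "real \<Rightarrow> (real \<Rightarrow> real) \<Rightarrow> real \<Rightarrow> real" where
  "tail_mean c \<phi> x = exp (2 * x) * integral {0..exp (- x)} (tail_kernel c \<phi>)"

lemma kernel_weight_nonneg:
  fixes c r :: real
  assumes "0 \<le> c" "c \<le> 1" "0 \<le> r" "r \<le> 1"
  shows "0 \<le> r - c * r\<^sup>2"
proof -
  have "c * r \<le> 1" using mult_mono[of c 1 r 1] assms by simp
  then have "r * (c * r) \<le> r" using mult_left_mono[of "c * r" 1 r] assms by simp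
  then show ?thesis by (simp add: power2_eq_square algebra_simps)
qed

lemma exp_half_ln_mult:
  assumes "0 < r" "r \<le> 1"
  shows "exp (\<bar>- ln r\<bar> / 2) * r = sqrt r"
proof -
  have "exp (\<bar>- ln r\<bar> / 2) * r = exp (- ln r / 2) * exp (ln r)"
    using assms by simp
  also have "\<dots> = exp (ln r / 2)" by (simp flip: exp_add)
  also have "\<dots> = sqrt r"
    using assms by (simp add: powr_half_sqrt[symmetric] powr_def)
  finally show ?thesis .
qed

lemma abs_tail_kernel_le:
  assumes c: "0 \<le> c" "c \<le> 1" and r: "0 \<le> r" "r \<le> 1" and g: "exp_half_growth D \<phi>"
  shows "\<bar>tail_kernel c \<phi> r\<bar> \<le> D * sqrt r"
proof (cases "r = 0")
  case False
  then have r': "0 < r" using r by simp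
  have "0 \<le> r - c * r\<^sup>2" using kernel_weight_nonneg c r .
  moreover have "r - c * r\<^sup>2 \<le> r" using c by simp
  ultimately have "\<bar>tail_kernel c \<phi> r\<bar> \<le> (D * exp (\<bar>- ln r\<bar> / 2)) * r"
    unfolding tail_kernel_def abs_mult using exp_half_growthD[OF g, of "- ln r"]
    by (intro mult_mono) auto
  then show ?thesis
    using exp_half_ln_mult[OF r' r(2)] by (simp add: mult.assoc)
qed (simp add: tail_kernel_def)

text \<open>The only critical point is \<open>r = 0\<close>, where the growth condition bounds the kernel by a multiple of
\<open>sqrt r\<close>, uniformly in the parameter.\<close>

lemma continuous_tail_kernel:
  assumes c: "0 \<le> c" "c \<le> 1" and \<phi>: "jointly_continuous \<phi>" and g: "\<And>p. exp_half_growth D (\<phi> p)"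
  shows "continuous_on (UNIV \<times> {0..}) (\<lambda>z. tail_kernel c (\<phi> (fst z)) (snd z))"
  unfolding continuous_on_eq_continuous_within
proof
  fix w :: "'a \<times> real"
  assume w: "w \<in> UNIV \<times> {0..}"
  show "continuous (at w within UNIV \<times> {0..}) (\<lambda>z. tail_kernel c (\<phi> (fst z)) (snd z))"
  proof (cases "snd w = 0")
    case False
    have op: "open (UNIV \<times> {0<..} :: ('a \<times> real) set)" by (intro open_Times) auto
    have "continuous_on (UNIV \<times> {0<..}) (\<lambda>z. tail_kernel c (\<phi> (fst z)) (snd z))"
      unfolding tail_kernel_def
      by (intro continuous_intros jointly_continuous_compose[OF \<phi>]) auto
    then have "continuous (at w) (\<lambda>z. tail_kernel c (\<phi> (fst z)) (snd z))"
      using w False op by (subst (asm) continuous_on_eq_continuous_at) (cases w; auto simp: mem_Times_iff)+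
    then show ?thesis by (rule continuous_at_imp_continuous_at_within)
  next
    case True
    have s: "((\<lambda>z. D * sqrt (snd z)) \<longlongrightarrow> D * sqrt (snd w)) (at w within UNIV \<times> {0..})"
      by (intro tendsto_intros)
    have "open {z :: 'a \<times> real. snd z < 1}" by (intro open_Collect_less continuous_intros)
    then have "\<forall>\<^sub>F z in at w within UNIV \<times> {0..}. z \<in> {z. snd z < 1}"
      using True unfolding eventually_at_topological by (intro exI[of _ "{z. snd z < 1}"]) auto
    moreover have "\<forall>\<^sub>F z in at w within UNIV \<times> {0..}. z \<in> UNIV \<times> {0..}"
      by (simp add: eventually_at_filter)
    ultimately have "\<forall>\<^sub>F z in at w within UNIV \<times> {0..}.
        norm (tail_kernel c (\<phi> (fst z)) (snd z)) \<le> D * sqrt (snd z)"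
      by eventually_elim (auto intro!: abs_tail_kernel_le c g)
    from Lim_null_comparison[OF this] s True
    show ?thesis by (simp add: continuous_within tail_kernel_def)
  qed
qed

lemma continuous_tail_kernel1:
  assumes "0 \<le> c" "c \<le> 1" "continuous_on UNIV \<phi>" "exp_half_growth D \<phi>"
  shows "continuous_on {0..} (tail_kernel c \<phi>)"
proof -
  have "jointly_continuous (\<lambda>_::real. \<phi>)"
    unfolding jointly_continuous_def
    by (rule continuous_on_compose2[OF assms(3)]) (auto intro!: continuous_intros)
  from continuous_tail_kernel[OF assms(1,2) this assms(4)]
  have "continuous_on {0..} (\<lambda>r. tail_kernel c \<phi> (snd (0 :: real, r)))"
    by (rule continuous_on_compose2) (auto intro!: continuous_intros)
  then show ?thesis by simp
qed

lemma jointly_continuous_tail_mean: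
  assumes "0 \<le> c" "c \<le> 1" "jointly_continuous \<phi>" "\<And>p. exp_half_growth D (\<phi> p)"
  shows "jointly_continuous (\<lambda>p. tail_mean c (\<phi> p))"
  unfolding jointly_continuous_def tail_mean_def
  by (intro continuous_intros continuous_on_compose2[OF continuous_integral_upto[OF
        continuous_tail_kernel[OF assms]], of _ "\<lambda>z. (fst z, exp (- snd z))", simplified])
    auto

lemma tail_kernel_integrable:
  assumes "0 \<le> c" "c \<le> 1" "continuous_on UNIV \<phi>" "exp_half_growth D \<phi>"
  shows "tail_kernel c \<phi> integrable_on {0..z}"
  by (intro integrable_continuous_interval continuous_on_subset[OF continuous_tail_kernel1[OF assms]]) auto

lemma tail_mean_linear:
  assumes c: "0 \<le> c" "c \<le> 1" and "continuous_on UNIV \<phi>" "exp_half_growth D \<phi>"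
    and "continuous_on UNIV \<psi>" "exp_half_growth D' \<psi>"
  shows "tail_mean c (\<lambda>\<xi>. a * \<phi> \<xi> + b * \<psi> \<xi>) x = a * tail_mean c \<phi> x + b * tail_mean c \<psi> x"
proof -
  have "tail_kernel c (\<lambda>\<xi>. a * \<phi> \<xi> + b * \<psi> \<xi>) = (\<lambda>r. a * tail_kernel c \<phi> r + b * tail_kernel c \<psi> r)"
    by (auto simp: tail_kernel_def algebra_simps)
  moreover have "tail_kernel c \<phi> integrable_on {0..exp (-x)}" "tail_kernel c \<psi> integrable_on {0..exp (-x)}"
    using tail_kernel_integrable assms by blast+
  ultimately show ?thesis
    by (simp add: tail_mean_def integral_add integrable_on_mult_right algebra_simps)
qed

lemma abs_tail_mean_le:
  assumes "0 \<le> c" "c \<le> 1" "continuous_on UNIV \<phi>" "exp_half_growth D \<phi>" and x: "0 \<le> x"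
  shows "\<bar>tail_mean c \<phi> x\<bar> \<le> D * exp (x / 2)"
proof -
  let ?z = "exp (- x)"
  have D: "0 \<le> D" using exp_half_growth_nonneg assms(4) .
  have z: "?z \<le> 1" using x by simp
  have "norm (integral {0..?z} (tail_kernel c \<phi>)) \<le> (D * sqrt ?z) * (?z - 0)"
  proof (rule integral_bound)
    show "continuous_on {0..?z} (tail_kernel c \<phi>)"
      by (rule continuous_on_subset[OF continuous_tail_kernel1[OF assms(1-4)]]) auto
    show "norm (tail_kernel c \<phi> t) \<le> D * sqrt ?z" if "t \<in> {0..?z}" for t
    proof -
      have "\<bar>tail_kernel c \<phi> t\<bar> \<le> D * sqrt t"
        using that z unfolding atLeastAtMost_iff by (intro abs_tail_kernel_le assms) linarith+
      also have "\<dots> \<le> D * sqrt ?z" using that D by (intro mult_left_mono) auto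
      finally show ?thesis by simp
    qed
  qed auto
  then have "\<bar>tail_mean c \<phi> x\<bar> \<le> exp (2 * x) * (D * sqrt ?z * ?z)"
    by (simp add: tail_mean_def abs_mult)
  also have "sqrt ?z = exp (- x / 2)"
    by (rule real_sqrt_unique) (auto simp flip: exp_double simp: power2_eq_square simp flip: exp_add)
  also have "exp (2 * x) * (D * exp (- x / 2) * ?z) = D * exp (2 * x + (- x / 2) + (- x))"
    by (simp only: exp_add) (simp add: algebra_simps)
  also have "2 * x + (- x / 2) + (- x) = x / 2" by simp
  finally show ?thesis .
qed

lemma tail_mean_const:
  "tail_mean c (\<lambda>_. k) x = k * (1 / 2 - c * exp (- x) / 3)"
proof -
  let ?z = "exp (- x)"
  have "((\<lambda>r. k * (r - c * r\<^sup>2)) has_integral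
      (k * (?z\<^sup>2 / 2 - c * ?z ^ 3 / 3) - k * (0\<^sup>2 / 2 - c * 0 ^ 3 / 3))) {0..?z}"
    by (rule fundamental_theorem_of_calculus)
      (auto intro!: derivative_eq_intros simp: has_real_derivative_iff_has_vector_derivative[symmetric]
        power2_eq_square power3_eq_cube algebra_simps)
  then have "integral {0..?z} (tail_kernel c (\<lambda>_. k)) = k * (?z\<^sup>2 / 2 - c * ?z ^ 3 / 3)"
    unfolding tail_kernel_def by (simp add: integral_unique del: integral_mult_right)
  moreover have "exp (2 * x) * ?z\<^sup>2 = 1" "exp (2 * x) * ?z ^ 3 = ?z"
    by (simp_all flip: exp_add exp_of_nat_mult add: field_simps)
  ultimately show ?thesis
    unfolding tail_mean_def by (simp add: right_diff_distrib mult.assoc mult.left_commute[of "exp (2 * x)"])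
qed

lemma tail_mean_mono:
  assumes c: "0 \<le> c" "c \<le> 1" and "continuous_on UNIV \<phi>" "exp_half_growth D \<phi>"
    and "continuous_on UNIV \<psi>" "exp_half_growth D' \<psi>" and x: "0 \<le> x"
    and le: "\<And>\<xi>. \<phi> \<xi> \<le> \<psi> \<xi>"
  shows "tail_mean c \<phi> x \<le> tail_mean c \<psi> x"
  unfolding tail_mean_def
proof (intro mult_left_mono integral_le)
  show "tail_kernel c \<phi> r \<le> tail_kernel c \<psi> r" if "r \<in> {0..exp (- x)}" for r
  proof -
    have "exp (- x) \<le> 1" using x by simp
    then have "r \<le> 1" "0 \<le> r" using that unfolding atLeastAtMost_iff by linarith+
    then have "0 \<le> r - c * r\<^sup>2" using kernel_weight_nonneg c by blast
    then show ?thesis unfolding tail_kernel_def by (intro mult_right_mono le)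
  qed
qed (use tail_kernel_integrable assms in \<open>auto\<close>)

section \<open>Fixed points of tail equations\<close>

lemma jointly_continuous_integral_upto:
  assumes "jointly_continuous k"
  shows "jointly_continuous (\<lambda>p x. integral {0..x} (k p))"
proof (rule jointly_continuousI)
  have "continuous_on (UNIV \<times> {0..}) (\<lambda>z. k (fst z) (snd z))"
    using assms unfolding jointly_continuous_def by (rule continuous_on_subset) auto
  from continuous_integral_upto[OF this]
  have "continuous_on UNIV (\<lambda>z. integral {0..snd (fst z, max 0 (snd z))} (k (fst (fst z, max 0 (snd z)))))"
    by (rule continuous_on_compose2) (auto intro!: continuous_intros)
  moreover have "integral {0..max 0 x} (k p) = integral {0..x} (k p)" for p x
    by (cases "x < 0") auto
  ultimately show "continuous_on UNIV (\<lambda>z. integral {0..snd z} (k (fst z)))"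
    by simp
qed

lemma jointly_continuous_slice:
  assumes "jointly_continuous \<phi>" shows "continuous_on S (\<phi> p)"
  by (rule jointly_continuous_compose[OF assms continuous_on_const continuous_on_id])

lemma has_integral_exp_half:
  assumes "0 \<le> (x :: real)"
  shows "((\<lambda>\<xi>. D * exp (\<xi> / 2)) has_integral 2 * D * (exp (x / 2) - 1)) {0..x}"
proof -
  have "((\<lambda>\<xi>. D * exp (\<xi> / 2)) has_integral 2 * D * exp (x / 2) - 2 * D * exp (0 / 2)) {0..x}"
    by (rule fundamental_theorem_of_calculus[OF assms])
      (auto intro!: derivative_eq_intros simp: has_real_derivative_iff_has_vector_derivative[symmetric])
  then show ?thesis by (simp add: algebra_simps)
qed

lemma abs_integral_exp_half_le:
  fixes f :: "real \<Rightarrow> real"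
  assumes f: "continuous_on UNIV f" and D: "0 \<le> D" and le: "\<And>\<xi>. 0 \<le> \<xi> \<Longrightarrow> \<bar>f \<xi>\<bar> \<le> D * exp (\<xi> / 2)"
  shows "\<bar>integral {0..x} f\<bar> \<le> 2 * D * exp (\<bar>x\<bar> / 2)"
proof (cases "0 \<le> x")
  case True
  have "norm (integral {0..x} f) \<le> integral {0..x} (\<lambda>\<xi>. D * exp (\<xi> / 2))"
    by (rule integral_norm_bound_integral)
      (use has_integral_exp_half[OF True] le in \<open>auto intro!: integrable_continuous_interval continuous_intros
        continuous_on_subset[OF f]\<close>)
  also have "\<dots> = 2 * D * (exp (x / 2) - 1)"
    using has_integral_exp_half[OF True] by (rule integral_unique)
  also have "\<dots> \<le> 2 * D * exp (\<bar>x\<bar> / 2)"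
    using D True by (simp add: algebra_simps)
  finally show ?thesis by simp
qed (use D in simp)

text \<open>The equation \<open>S p x = \<integral> H p \<xi> (tail_mean c (\<lambda>\<eta>. N p \<eta> (S p \<eta>)) \<xi>)\<close>, integrated over \<open>\<xi>\<close> from \<open>0\<close> to \<open>x\<close>,
with a parameter \<open>p\<close>. Two instances occur below: the equation of the elapsed time, and the linear
equation of its difference quotients. The weight \<open>exp (x / 2)\<close> is its own integral up to a factor \<open>2\<close>,
so that the Lipschitz constants \<open>l\<close> and \<open>M\<close> of \<open>N\<close> and \<open>H\<close> combine to \<open>2 l M\<close>; the assumption \<open>small\<close> makes
this at most \<open>1 / 2\<close>.\<close>

locale tail_equation =
  fixes c K l M :: real and N H :: "'p::metric_space \<Rightarrow> real \<Rightarrow> real \<Rightarrow> real"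
  assumes c: "0 \<le> c" "c \<le> 1" and l: "0 \<le> l" and M: "0 \<le> M" and small: "4 * l * M \<le> 1"
    and N_cont: "continuous_on UNIV (\<lambda>z. N (fst z) (fst (snd z)) (snd (snd z)))"
    and H_cont: "continuous_on UNIV (\<lambda>z. H (fst z) (fst (snd z)) (snd (snd z)))"
    and N_lip: "\<And>p \<xi> s t. \<bar>N p \<xi> s - N p \<xi> t\<bar> \<le> l * \<bar>s - t\<bar>"
    and H_lip: "\<And>p \<xi> s t. \<bar>H p \<xi> s - H p \<xi> t\<bar> \<le> M * \<bar>s - t\<bar>"
    and N_growth: "\<And>p. exp_half_growth K (\<lambda>\<xi>. N p \<xi> 0)"
    and H_growth: "\<And>p. exp_half_growth K (\<lambda>\<xi>. H p \<xi> 0)"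
begin

definition integrand :: "'p \<Rightarrow> (real \<Rightarrow> real) \<Rightarrow> real \<Rightarrow> real" where
  "integrand p s \<xi> = H p \<xi> (tail_mean c (\<lambda>\<eta>. N p \<eta> (s \<eta>)) \<xi>)"

definition step :: "'p \<Rightarrow> (real \<Rightarrow> real) \<Rightarrow> real \<Rightarrow> real" where
  "step p s x = integral {0..x} (integrand p s)"

lemma K_nonneg: "0 \<le> K"
  using N_growth by (rule exp_half_growth_nonneg)

lemma N_compose:
  assumes "continuous_on S f" "continuous_on S g" "continuous_on S h"
  shows "continuous_on S (\<lambda>x. N (f x) (g x) (h x))"
proof -
  have "continuous_on S (\<lambda>x. (f x, g x, h x))"
    using assms by (intro continuous_intros)
  from continuous_on_compose2[OF N_cont this] show ?thesis by simp
qed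

lemma H_compose:
  assumes "continuous_on S f" "continuous_on S g" "continuous_on S h"
  shows "continuous_on S (\<lambda>x. H (f x) (g x) (h x))"
proof -
  have "continuous_on S (\<lambda>x. (f x, g x, h x))"
    using assms by (intro continuous_intros)
  from continuous_on_compose2[OF H_cont this] show ?thesis by simp
qed

lemma N_growth_compose:
  assumes "exp_half_growth B s"
  shows "exp_half_growth (K + l * B) (\<lambda>\<xi>. N p \<xi> (s \<xi>))"
  unfolding exp_half_growth_def
proof
  fix \<xi>
  have "\<bar>N p \<xi> (s \<xi>)\<bar> \<le> \<bar>N p \<xi> 0\<bar> + l * \<bar>s \<xi>\<bar>"
    using N_lip[of p \<xi> "s \<xi>" 0] by simp
  also have "\<dots> \<le> K * exp (\<bar>\<xi>\<bar> / 2) + l * (B * exp (\<bar>\<xi>\<bar> / 2))"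
    by (intro add_mono mult_left_mono exp_half_growthD[OF N_growth] exp_half_growthD[OF assms] l)
  finally show "\<bar>N p \<xi> (s \<xi>)\<bar> \<le> (K + l * B) * exp (\<bar>\<xi>\<bar> / 2)"
    by (simp add: algebra_simps)
qed

lemma continuous_integrand:
  assumes "jointly_continuous s" "\<And>p. exp_half_growth B (s p)"
  shows "jointly_continuous (\<lambda>p. integrand p (s p))"
proof -
  have "jointly_continuous (\<lambda>p \<eta>. N p \<eta> (s p \<eta>))"
    by (intro jointly_continuousI N_compose continuous_intros jointly_continuous_compose[OF assms(1)])
  from jointly_continuous_tail_mean[OF c this N_growth_compose[OF assms(2)]]
  show ?thesis
    unfolding integrand_def
    by (intro jointly_continuousI H_compose continuous_intros) (simp add: jointly_continuous_def)
qed

lemma continuous_integrand1: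
  assumes "continuous_on UNIV s" "exp_half_growth B s"
  shows "continuous_on UNIV (integrand p s)"
proof -
  have "jointly_continuous (\<lambda>_::'p. s)"
    unfolding jointly_continuous_def
    by (rule continuous_on_compose2[OF assms(1)]) (auto intro!: continuous_intros)
  from continuous_integrand[OF this assms(2)] show ?thesis
    by (rule jointly_continuous_slice)
qed

lemma integrand_le:
  assumes "continuous_on UNIV s" "exp_half_growth B s" "0 \<le> \<xi>"
  shows "\<bar>integrand p s \<xi>\<bar> \<le> (K + M * (K + l * B)) * exp (\<xi> / 2)"
proof -
  have "continuous_on UNIV (\<lambda>\<eta>. N p \<eta> (s \<eta>))"
    by (intro N_compose continuous_intros assms)
  from abs_tail_mean_le[OF c this N_growth_compose[OF assms(2)] assms(3)]
  have "M * \<bar>tail_mean c (\<lambda>\<eta>. N p \<eta> (s \<eta>)) \<xi>\<bar> \<le> M * ((K + l * B) * exp (\<xi> / 2))"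
    using M by (intro mult_left_mono) auto
  moreover have "\<bar>integrand p s \<xi>\<bar> \<le> \<bar>H p \<xi> 0\<bar> + M * \<bar>tail_mean c (\<lambda>\<eta>. N p \<eta> (s \<eta>)) \<xi>\<bar>"
    using H_lip[of p \<xi> "tail_mean c (\<lambda>\<eta>. N p \<eta> (s \<eta>)) \<xi>" 0] by (simp add: integrand_def)
  moreover have "\<bar>H p \<xi> 0\<bar> \<le> K * exp (\<xi> / 2)"
    using exp_half_growthD[OF H_growth[of p], of \<xi>] assms(3) by simp
  ultimately show ?thesis by (simp add: algebra_simps)
qed

lemma step_growth:
  assumes "continuous_on UNIV s" "exp_half_growth B s"
  shows "exp_half_growth (2 * (K + M * (K + l * B))) (step p s)"
  unfolding exp_half_growth_def step_def
  using K_nonneg M l exp_half_growth_nonneg[OF assms(2)]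
  by (intro allI abs_integral_exp_half_le continuous_integrand1[OF assms] integrand_le[OF assms]) auto

lemma step_contracts:
  assumes s: "continuous_on UNIV s" "exp_half_growth B s" and t: "continuous_on UNIV t" "exp_half_growth B' t"
    and d: "exp_half_growth D (\<lambda>\<xi>. s \<xi> - t \<xi>)"
  shows "exp_half_growth (D / 2) (\<lambda>x. step p s x - step p t x)"
  unfolding exp_half_growth_def
proof
  fix x
  have D: "0 \<le> D" using d by (rule exp_half_growth_nonneg)
  have cs: "continuous_on UNIV (\<lambda>\<eta>. N p \<eta> (s \<eta>))" and ct: "continuous_on UNIV (\<lambda>\<eta>. N p \<eta> (t \<eta>))"
    by (intro N_compose continuous_intros s t)+
  note cis = continuous_integrand1[OF s, of p] and cit = continuous_integrand1[OF t, of p]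
  have "exp_half_growth (l * D) (\<lambda>\<eta>. 1 * N p \<eta> (s \<eta>) + (-1) * N p \<eta> (t \<eta>))"
    unfolding exp_half_growth_def
  proof
    fix \<eta>
    have "\<bar>N p \<eta> (s \<eta>) - N p \<eta> (t \<eta>)\<bar> \<le> l * (D * exp (\<bar>\<eta>\<bar> / 2))"
      using N_lip[of p \<eta> "s \<eta>" "t \<eta>"] mult_left_mono[OF exp_half_growthD[OF d, of \<eta>] l] by linarith
    then show "\<bar>1 * N p \<eta> (s \<eta>) + (-1) * N p \<eta> (t \<eta>)\<bar> \<le> l * D * exp (\<bar>\<eta>\<bar> / 2)"
      by (simp add: mult.assoc)
  qed
  then have tm: "\<bar>tail_mean c (\<lambda>\<eta>. N p \<eta> (s \<eta>)) \<xi> - tail_mean c (\<lambda>\<eta>. N p \<eta> (t \<eta>)) \<xi>\<bar> \<le> l * D * exp (\<xi> / 2)"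
    if "0 \<le> \<xi>" for \<xi>
    using abs_tail_mean_le[OF c _ _ that, of "\<lambda>\<eta>. 1 * N p \<eta> (s \<eta>) + (-1) * N p \<eta> (t \<eta>)" "l * D"]
      tail_mean_linear[OF c cs N_growth_compose[OF s(2)] ct N_growth_compose[OF t(2)], of 1 "-1" \<xi>]
    by (simp add: continuous_on_diff cs ct)
  have "\<bar>integral {0..x} (\<lambda>\<xi>. integrand p s \<xi> - integrand p t \<xi>)\<bar> \<le> 2 * (M * (l * D)) * exp (\<bar>x\<bar> / 2)"
  proof (rule abs_integral_exp_half_le)
    fix \<xi> :: real assume "0 \<le> \<xi>"
    have "\<bar>integrand p s \<xi> - integrand p t \<xi>\<bar> \<le> M * (l * D * exp (\<xi> / 2))"
      using H_lip mult_left_mono[OF tm[OF \<open>0 \<le> \<xi>\<close>] M] unfolding integrand_def by (rule order_trans)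
    then show "\<bar>integrand p s \<xi> - integrand p t \<xi>\<bar> \<le> M * (l * D) * exp (\<xi> / 2)"
      by (simp add: mult.assoc)
  qed (use cis cit M l D in \<open>auto intro!: continuous_intros\<close>)
  moreover have "integral {0..x} (\<lambda>\<xi>. integrand p s \<xi> - integrand p t \<xi>) = step p s x - step p t x"
    unfolding step_def
    by (intro integral_diff integrable_continuous_interval continuous_on_subset[OF cis] continuous_on_subset[OF cit]) auto
  moreover have "2 * (M * (l * D)) * exp (\<bar>x\<bar> / 2) \<le> D / 2 * exp (\<bar>x\<bar> / 2)"
    using mult_right_mono[OF small D] by (intro mult_right_mono) (auto simp: algebra_simps)
  ultimately show "\<bar>step p s x - step p t x\<bar> \<le> D / 2 * exp (\<bar>x\<bar> / 2)" by linarith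
qed

lemma fixed_point_unique:
  assumes s: "continuous_on UNIV s" "exp_half_growth B s" "\<And>x. s x = step p s x"
    and t: "continuous_on UNIV t" "exp_half_growth B' t" "\<And>x. t x = step p t x"
  shows "s x = t x"
proof -
  \<comment> \<open>Each step halves the weighted distance, which is finite.\<close>
  have it: "exp_half_growth ((B + B') / 2 ^ n) (\<lambda>\<xi>. s \<xi> - t \<xi>)" for n
  proof (induction n)
    case 0
    have "\<bar>s \<xi> - t \<xi>\<bar> \<le> (B + B') * exp (\<bar>\<xi>\<bar> / 2)" for \<xi>
      using exp_half_growthD[OF s(2), of \<xi>] exp_half_growthD[OF t(2), of \<xi>] by (simp add: algebra_simps)
    then show ?case by (simp add: exp_half_growth_def)
  next
    case (Suc n)
    from step_contracts[OF s(1,2) t(1,2) Suc, of p] show ?case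
      by (simp add: s(3)[symmetric] t(3)[symmetric] mult.commute)
  qed
  have "(\<lambda>n. (B + B') * (1 / 2) ^ n * exp (\<bar>x\<bar> / 2)) \<longlonglongrightarrow> (B + B') * 0 * exp (\<bar>x\<bar> / 2)"
    by (intro tendsto_intros LIMSEQ_power_zero) auto
  then have "\<bar>s x - t x\<bar> \<le> (B + B') * 0 * exp (\<bar>x\<bar> / 2)"
    using exp_half_growthD[OF it, where \<xi> = x]
    by (intro tendsto_lowerbound) (auto simp: power_divide)
  then show ?thesis by simp
qed

text \<open>Banach's theorem in the space of bounded continuous functions of \<open>(p, x)\<close>, not for each \<open>p\<close> separately:
this yields joint continuity in the parameter and in \<open>x\<close>.\<close>

lemma fixed_point_exists:
  obtains S B where "jointly_continuous S" "\<And>p. exp_half_growth B (S p)" "\<And>p x. S p x = step p (S p) x"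
proof -
  \<comment> \<open>The fixed point is sought in the form \<open>exp (|x| / 2)\<close> times a bounded continuous function.\<close>
  define unweight :: "(('p \<times> real) \<Rightarrow>\<^sub>C real) \<Rightarrow> 'p \<Rightarrow> real \<Rightarrow> real"
    where "unweight f p \<xi> = exp (\<bar>\<xi>\<bar> / 2) * apply_bcontfun f (p, \<xi>)" for f p \<xi>
  define F where "F f = Bcontfun (\<lambda>z. exp (- \<bar>snd z\<bar> / 2) * step (fst z) (unweight f (fst z)) (snd z))" for f
  have uc: "jointly_continuous (unweight f)" for f
    unfolding unweight_def by (intro jointly_continuousI continuous_intros continuous_on_compose2[OF continuous_on_apply_bcontfun[of UNIV]]) auto
  have ug: "exp_half_growth (norm f) (unweight f p)" for f p
  proof -
    have "exp (\<bar>\<xi>\<bar> / 2) * \<bar>apply_bcontfun f (p, \<xi>)\<bar> \<le> exp (\<bar>\<xi>\<bar> / 2) * norm f" for \<xi>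
      using norm_bounded[of f "(p, \<xi>)"] by (intro mult_left_mono) auto
    then show ?thesis by (simp add: exp_half_growth_def unweight_def abs_mult mult.commute)
  qed
  have u1: "continuous_on UNIV (unweight f p)" for f p
    using uc by (rule jointly_continuous_slice)
  have sc: "jointly_continuous (\<lambda>p. step p (unweight f p))" for f
    unfolding step_def by (intro jointly_continuous_integral_upto continuous_integrand[OF uc ug])
  have w: "exp (- \<bar>x\<bar> / 2) * exp (\<bar>x\<bar> / 2) = 1" for x :: real
    by (simp flip: exp_add)
  have drop_weight: "norm (exp (- \<bar>x\<bar> / 2) * v) \<le> C" if "\<bar>v\<bar> \<le> C * exp (\<bar>x\<bar> / 2)" for v C x :: real
  proof -
    have "exp (- \<bar>x\<bar> / 2) * \<bar>v\<bar> \<le> exp (- \<bar>x\<bar> / 2) * (C * exp (\<bar>x\<bar> / 2))"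
      using that by (intro mult_left_mono) auto
    also have "\<dots> = C * (exp (- \<bar>x\<bar> / 2) * exp (\<bar>x\<bar> / 2))" by (simp only: mult_ac)
    finally show ?thesis unfolding w by (simp add: abs_mult)
  qed
  have F: "apply_bcontfun (F f) z = exp (- \<bar>snd z\<bar> / 2) * step (fst z) (unweight f (fst z)) (snd z)" for f z
    unfolding F_def
  proof (subst Bcontfun_inverse)
    show "(\<lambda>z. exp (- \<bar>snd z\<bar> / 2) * step (fst z) (unweight f (fst z)) (snd z)) \<in> bcontfun"
    proof (rule bcontfun_normI)
      show "continuous_on UNIV (\<lambda>z. exp (- \<bar>snd z\<bar> / 2) * step (fst z) (unweight f (fst z)) (snd z))"
        using sc by (auto simp: jointly_continuous_def intro!: continuous_intros)
      fix z :: "'p \<times> real"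
      show "norm (exp (- \<bar>snd z\<bar> / 2) * step (fst z) (unweight f (fst z)) (snd z)) \<le> 2 * (K + M * (K + l * norm f))"
        by (rule drop_weight[OF exp_half_growthD[OF step_growth[OF u1 ug]]])
    qed
  qed simp
  have "dist (F f) (F g) \<le> 1 / 2 * dist f g" for f g
  proof (rule dist_bound)
    fix z :: "'p \<times> real"
    have "exp_half_growth (dist f g) (\<lambda>\<xi>. unweight f (fst z) \<xi> - unweight g (fst z) \<xi>)"
    proof -
      have "exp (\<bar>\<xi>\<bar> / 2) * \<bar>apply_bcontfun f (fst z, \<xi>) - apply_bcontfun g (fst z, \<xi>)\<bar> \<le> exp (\<bar>\<xi>\<bar> / 2) * dist f g" for \<xi>
        using dist_bounded[of f "(fst z, \<xi>)" g] by (intro mult_left_mono) (auto simp: dist_real_def)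
      then show ?thesis
        unfolding exp_half_growth_def unweight_def right_diff_distrib[symmetric] abs_mult
        by (simp add: mult.commute)
    qed
    note contract = step_contracts[OF u1 ug u1 ug this, of "fst z"]
    from drop_weight[OF exp_half_growthD[OF contract, of "snd z"]]
    show "dist (apply_bcontfun (F f) z) (apply_bcontfun (F g) z) \<le> 1 / 2 * dist f g"
      by (simp add: F dist_real_def flip: right_diff_distrib)
  qed
  then obtain f where f: "F f = f"
    using banach_fix_type[of "1/2" F] by auto
  have "unweight f p x = step p (unweight f p) x" for p x
    using F[of f "(p, x)"] w[of x] unfolding f by (simp add: unweight_def mult.assoc[symmetric] mult.commute)
  then show ?thesis using that uc ug by blast
qed

end

section \<open>Elapsed time along a decaying solution\<close>

lemma inverse_diff:
  fixes r s :: real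
  assumes "0 < r" "0 < s"
  shows "1 / r - 1 / s = - (r\<^sup>2 - s\<^sup>2) / (r * s * (r + s))"
proof -
  have "r + s \<noteq> 0" using assms by simp
  have "- (r\<^sup>2 - s\<^sup>2) / (r * s * (r + s)) = ((s - r) * (r + s)) / ((r * s) * (r + s))"
    by (simp add: power2_eq_square algebra_simps)
  also have "\<dots> = (s - r) / (r * s)"
    using \<open>r + s \<noteq> 0\<close> by (rule nonzero_mult_divide_mult_cancel_right)
  finally show ?thesis using assms by (simp add: field_simps)
qed

text \<open>The one-sided problem of the introduction. The range of \<open>a\<close> enters through the energy estimate, the
bound on \<open>a'\<close> through the contraction, and the continuity of \<open>a'\<close> through the difference quotients.\<close>

locale slow_reaction =
  fixes a a' :: "real \<Rightarrow> real" and c L :: real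
  assumes c: "0 < c" "c < 1" and L: "0 \<le> L"
    and a_deriv: "\<And>y. (a has_real_derivative a' y) (at y)"
    and a'_cont: "continuous_on UNIV a'"
    and a'_bound: "\<And>y. \<bar>a' y\<bar> \<le> L"
    and a_range: "\<And>y. 1 / 2 \<le> a y" "\<And>y. a y \<le> 1"
begin

lemma c': "0 \<le> c" "c \<le> 1"
  using c by auto

lemma a_cont: "continuous_on UNIV a"
  using a_deriv by (meson DERIV_continuous_on has_field_derivative_at_within)

lemma a_compose [continuous_intros]: "continuous_on S f \<Longrightarrow> continuous_on S (\<lambda>x. a (f x))"
  using continuous_on_compose2[OF a_cont] by auto

lemma a_diff_le: "\<bar>a x - a y\<bar> \<le> L * \<bar>x - y\<bar>"
  using field_differentiable_bound[of UNIV a a' L x y] a_deriv a'_bound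
  by (auto intro: has_field_derivative_at_within)

text \<open>The slope of the chord of \<open>a\<close> between \<open>y\<close> and \<open>x\<close>, written as a mean of the derivative so that it is
continuous across the diagonal.\<close>

definition chord :: "real \<Rightarrow> real \<Rightarrow> real" where
  "chord x y = integral {0..1} (\<lambda>s. a' (y + s * (x - y)))"

lemma chord_mult: "chord x y * (x - y) = a x - a y"
proof -
  have "((\<lambda>s. a' (y + s * (x - y)) * (x - y)) has_integral a (y + 1 * (x - y)) - a (y + 0 * (x - y))) {0..1}"
    by (rule fundamental_theorem_of_calculus)
      (auto intro!: derivative_eq_intros DERIV_chain2[OF a_deriv]
        simp: has_real_derivative_iff_has_vector_derivative[symmetric])
  then show ?thesis by (simp add: chord_def integral_unique flip: integral_mult_left)
qed

lemma jointly_continuous_chord: "jointly_continuous chord"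
proof (rule jointly_continuousI)
  have "continuous_on (UNIV \<times> cbox 0 1) (\<lambda>(z :: real \<times> real, s). a' (snd z + s * (fst z - snd z)))"
    unfolding case_prod_unfold
    by (rule continuous_on_compose2[OF a'_cont]) (auto intro!: continuous_intros)
  from integral_continuous_on_param[OF this]
  show "continuous_on UNIV (\<lambda>z. chord (fst z) (snd z))" by (simp add: chord_def)
qed

lemma abs_chord_le: "\<bar>chord x y\<bar> \<le> L"
proof -
  have "norm (integral {0..1} (\<lambda>s. a' (y + s * (x - y)))) \<le> L * (1 - 0)"
    by (rule integral_bound)
      (auto intro!: continuous_on_compose2[OF a'_cont] continuous_intros simp: a'_bound)
  then show ?thesis by (simp add: chord_def)
qed

text \<open>With \<open>v = profile x\<close> the energy is \<open>v'^2 / 2 = v^2 (v^2 / 4 - v / 3 + j)\<close>, where \<open>j\<close> is the tail mean of \<open>a\<close>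
along the solution. Thus \<open>rate x j\<close> below is \<open>- v' / v\<close>, the speed \<open>dx/ds\<close>. Replacing \<open>a\<close> by its lower bound
\<open>1 / 2\<close> turns \<open>v^2 / 4 - v / 3 + j\<close> into \<open>(1 - v)^2 / 4\<close>, which is at least \<open>(1 - c)^2 / 4\<close>. The maximum in
\<open>rate\<close> therefore changes nothing along a solution; it only makes \<open>rate\<close> globally Lipschitz.\<close>

definition rate_min :: real where
  "rate_min = sqrt ((1 - c)\<^sup>2 / 2)"

lemma rate_min: "0 < rate_min" "rate_min < 1"
proof -
  show "0 < rate_min" using c by (simp add: rate_min_def)
  have "(1 - c)\<^sup>2 < 1" using c by (simp add: power_less_one_iff)
  then show "rate_min < 1" by (simp add: rate_min_def)
qed

definition profile :: "real \<Rightarrow> real" where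
  "profile x = c * exp (- x)"

definition rate :: "real \<Rightarrow> real \<Rightarrow> real" where
  "rate x j = sqrt (2 * max ((1 - c)\<^sup>2 / 4) ((profile x)\<^sup>2 / 4 - profile x / 3 + j))"

lemma jointly_continuous_rate: "jointly_continuous rate"
  unfolding rate_def profile_def by (intro jointly_continuousI continuous_intros) auto

lemma rate_ge: "rate_min \<le> rate x j"
  unfolding rate_def rate_min_def by (intro real_sqrt_le_mono) (simp add: max_def)

lemma rate_pos: "0 < rate x j"
  using rate_ge[of x j] rate_min by simp

lemma rate_sq: "(rate x j)\<^sup>2 = 2 * max ((1 - c)\<^sup>2 / 4) ((profile x)\<^sup>2 / 4 - profile x / 3 + j)"
  proof -
  have "0 \<le> max ((1 - c)\<^sup>2 / 4) ((profile x)\<^sup>2 / 4 - profile x / 3 + j)"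
    by (rule max.coboundedI1) simp
  then show ?thesis by (simp add: rate_def)
qed

lemma rate_sq_diff_le: "\<bar>(rate x i)\<^sup>2 - (rate x j)\<^sup>2\<bar> \<le> 2 * \<bar>i - j\<bar>"
  proof -
  have "\<bar>2 * max A (B + i) - 2 * max A (B + j)\<bar> \<le> 2 * \<bar>i - j\<bar>" for A B :: real
    unfolding max_def by (smt (verit))
  then show ?thesis unfolding rate_sq by blast
qed

text \<open>Lipschitz constant of \<open>j \<mapsto> 1 / rate x j\<close>.\<close>

definition lip :: real where "lip = 1 / rate_min ^ 3"

lemma lip_pos: "0 < lip" using rate_min by (simp add: lip_def)

lemma inverse_rate_product_le:
  assumes "rate_min \<le> r" "rate_min \<le> s"
  shows "2 / (r * s * (r + s)) \<le> lip"
proof -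
  have "rate_min * rate_min * (rate_min + rate_min) \<le> r * s * (r + s)"
    using assms rate_min by (intro mult_mono add_mono) auto
  then have "2 / (r * s * (r + s)) \<le> 2 / (rate_min * rate_min * (rate_min + rate_min))"
    using rate_min assms by (intro divide_left_mono mult_pos_pos) auto
  also have "\<dots> = lip" by (simp add: lip_def power3_eq_cube)
  finally show ?thesis .
qed

lemma inverse_rate_lipschitz: "\<bar>1 / rate x i - 1 / rate x j\<bar> \<le> lip * \<bar>i - j\<bar>"
proof -
  let ?P = "rate x i * rate x j * (rate x i + rate x j)"
  have P: "0 < ?P" using rate_pos by (intro mult_pos_pos add_pos_pos)
  have "\<bar>1 / rate x i - 1 / rate x j\<bar> = \<bar>(rate x i)\<^sup>2 - (rate x j)\<^sup>2\<bar> / ?P"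
    unfolding inverse_diff[OF rate_pos rate_pos] using P by (simp add: abs_minus_commute)
  also have "\<dots> \<le> (2 * \<bar>i - j\<bar>) / ?P"
    using P rate_sq_diff_le by (intro divide_right_mono) auto
  also have "\<dots> = 2 / ?P * \<bar>i - j\<bar>" by simp
  also have "\<dots> \<le> lip * \<bar>i - j\<bar>"
    by (intro mult_right_mono inverse_rate_product_le rate_ge) auto
  finally show ?thesis .
qed

text \<open>The smallness of \<open>\<epsilon>\<close> that makes the equation of the elapsed time contracting; \<open>L + 1\<close> instead of \<open>L\<close>
avoids a division by zero for constant \<open>a\<close>.\<close>

definition eps_max :: real where "eps_max = 1 / (4 * (L + 1) * lip)"

lemma eps_max_pos: "0 < eps_max" using L lip_pos by (simp add: eps_max_def)

lemma eps_max_small: "4 * (eps_max * L) * lip \<le> 1"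
proof -
  have "4 * L * lip \<le> 4 * (L + 1) * lip" "0 < 4 * (L + 1) * lip"
    using L lip_pos by (auto intro!: mult_right_mono)
  then have "4 * L * lip / (4 * (L + 1) * lip) \<le> 1" by (simp only: divide_le_eq_1_pos)
  moreover have "4 * (eps_max * L) * lip = 4 * L * lip / (4 * (L + 1) * lip)"
    by (simp only: eps_max_def) simp
  ultimately show ?thesis by simp
qed

text \<open>Truncating \<open>\<epsilon>\<close> lets all functions below be defined and continuous for all parameters.\<close>

definition clamp_eps :: "real \<Rightarrow> real" where
  "clamp_eps e = max (- eps_max) (min eps_max e)"

lemma clamp_eps_id: "\<bar>e\<bar> \<le> eps_max \<Longrightarrow> clamp_eps e = e"
  by (auto simp: clamp_eps_def)

lemma abs_clamp_eps: "\<bar>clamp_eps e\<bar> \<le> eps_max"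
  using eps_max_pos by (auto simp: clamp_eps_def)

lemma clamp_eps_cont [continuous_intros]:
  "continuous_on S f \<Longrightarrow> continuous_on S (\<lambda>x. clamp_eps (f x))"
  unfolding clamp_eps_def by (intro continuous_intros)

text \<open>The elapsed time is the integral of \<open>1 / rate\<close>, and \<open>a\<close> is evaluated at the phase \<open>y + \<epsilon> T\<close>.\<close>

sublocale T: tail_equation c "1 / rate_min" "eps_max * L" lip
  "\<lambda>p \<xi> s. a (snd p + clamp_eps (fst p) * s)" "\<lambda>(p :: real \<times> real) \<xi> j. 1 / rate \<xi> j"
proof
  show "0 \<le> c" "c \<le> 1" "0 \<le> eps_max * L" "0 \<le> lip" "4 * (eps_max * L) * lip \<le> 1"
    using c' L eps_max_pos lip_pos eps_max_small by auto
  show "continuous_on UNIV (\<lambda>z :: (real \<times> real) \<times> real \<times> real.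
      a (snd (fst z) + clamp_eps (fst (fst z)) * snd (snd z)))"
    by (intro continuous_intros)
  show "continuous_on UNIV (\<lambda>z :: (real \<times> real) \<times> real \<times> real. 1 / rate (fst (snd z)) (snd (snd z)))"
    using rate_pos
    by (intro continuous_intros jointly_continuous_compose[OF jointly_continuous_rate]) (auto simp: less_imp_neq[symmetric])
  show "\<bar>a (snd p + clamp_eps (fst p) * s) - a (snd p + clamp_eps (fst p) * t)\<bar> \<le> eps_max * L * \<bar>s - t\<bar>"
    for p :: "real \<times> real" and s t
  proof -
    have "\<bar>a (snd p + clamp_eps (fst p) * s) - a (snd p + clamp_eps (fst p) * t)\<bar> \<le> L * (\<bar>clamp_eps (fst p)\<bar> * \<bar>s - t\<bar>)"
      using a_diff_le[of "snd p + clamp_eps (fst p) * s" "snd p + clamp_eps (fst p) * t"]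
      by (simp add: abs_mult flip: right_diff_distrib)
    also have "\<dots> \<le> L * (eps_max * \<bar>s - t\<bar>)"
      using L abs_clamp_eps by (intro mult_left_mono mult_right_mono) auto
    finally show ?thesis by (simp add: mult_ac)
  qed
  show "\<bar>1 / rate \<xi> s - 1 / rate \<xi> t\<bar> \<le> lip * \<bar>s - t\<bar>" for \<xi> s t
    by (rule inverse_rate_lipschitz)
  show "exp_half_growth (1 / rate_min) (\<lambda>\<xi>. a (snd p + clamp_eps (fst p) * 0))" for p :: "real \<times> real"
  proof (rule exp_half_growthI_bounded)
    have "1 \<le> 1 / rate_min" using rate_min by simp
    then show "\<bar>a (snd p + clamp_eps (fst p) * 0)\<bar> \<le> 1 / rate_min"
      using a_range[of "snd p + clamp_eps (fst p) * 0"] by linarith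
  qed
  show "exp_half_growth (1 / rate_min) (\<lambda>\<xi>. 1 / rate \<xi> 0)"
    using rate_ge rate_min rate_pos
    by (intro exp_half_growthI_bounded) (auto intro!: divide_left_mono mult_pos_pos simp: less_imp_le)
qed

definition elapsed :: "real \<times> real \<Rightarrow> real \<Rightarrow> real" where
  "elapsed = (SOME S. jointly_continuous S \<and> (\<exists>B. \<forall>p. exp_half_growth B (S p)) \<and> (\<forall>p x. S p x = T.step p (S p) x))"

lemma elapsed_spec:
  "jointly_continuous elapsed \<and> (\<exists>B. \<forall>p. exp_half_growth B (elapsed p)) \<and> (\<forall>p x. elapsed p x = T.step p (elapsed p) x)"
proof -
  have "\<exists>S. jointly_continuous S \<and> (\<exists>B. \<forall>p. exp_half_growth B (S p)) \<and> (\<forall>p x. S p x = T.step p (S p) x)"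
    by (rule T.fixed_point_exists) blast
  from someI_ex[OF this] show ?thesis unfolding elapsed_def .
qed

lemma jointly_continuous_elapsed: "jointly_continuous elapsed"
  using elapsed_spec by blast

lemma elapsed_growth: obtains B where "\<And>p. exp_half_growth B (elapsed p)"
  using elapsed_spec by blast

definition phase :: "real \<times> real \<Rightarrow> real \<Rightarrow> real" where
  "phase p x = snd p + clamp_eps (fst p) * elapsed p x"

definition potential :: "real \<times> real \<Rightarrow> real \<Rightarrow> real" where
  "potential p = tail_mean c (\<lambda>\<eta>. a (phase p \<eta>))"

definition decay_rate :: "real \<times> real \<Rightarrow> real \<Rightarrow> real" where
  "decay_rate p x = rate x (potential p x)"

lemma elapsed_eq: "elapsed p x = integral {0..x} (\<lambda>\<xi>. 1 / decay_rate p \<xi>)"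
proof -
  have "elapsed p x = T.step p (elapsed p) x" using elapsed_spec by blast
  also have "\<dots> = integral {0..x} (\<lambda>\<xi>. 1 / decay_rate p \<xi>)"
    unfolding T.step_def T.integrand_def decay_rate_def potential_def phase_def ..
  finally show ?thesis .
qed

lemma jointly_continuous_phase: "jointly_continuous phase"
  unfolding phase_def
  by (intro jointly_continuousI continuous_intros jointly_continuous_compose[OF jointly_continuous_elapsed])

lemma phase_compose [continuous_intros]:
  "continuous_on S f \<Longrightarrow> continuous_on S g \<Longrightarrow> continuous_on S (\<lambda>x. phase (f x) (g x))"
  by (rule jointly_continuous_compose[OF jointly_continuous_phase])

lemma a_growth: "exp_half_growth 1 (\<lambda>\<eta>. a (f \<eta>))"
proof (rule exp_half_growthI_bounded)
  show "\<bar>a (f \<eta>)\<bar> \<le> 1" for \<eta> using a_range[of "f \<eta>"] by simp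
qed

lemma jointly_continuous_potential: "jointly_continuous potential"
  unfolding potential_def
  by (rule jointly_continuous_tail_mean[OF c' _ a_growth]) (intro jointly_continuousI continuous_intros)

lemma jointly_continuous_decay_rate: "jointly_continuous decay_rate"
  unfolding decay_rate_def
  by (intro jointly_continuousI jointly_continuous_compose[OF jointly_continuous_rate]
      jointly_continuous_compose[OF jointly_continuous_potential] continuous_intros)

lemma decay_rate_compose [continuous_intros]:
  "continuous_on S f \<Longrightarrow> continuous_on S g \<Longrightarrow> continuous_on S (\<lambda>x. decay_rate (f x) (g x))"
  by (rule jointly_continuous_compose[OF jointly_continuous_decay_rate])

lemma decay_rate_pos: "0 < decay_rate p x" and decay_rate_ge: "rate_min \<le> decay_rate p x"
  unfolding decay_rate_def by (rule rate_pos rate_ge)+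

lemma decay_rate_nonzero [simp]: "decay_rate p x \<noteq> 0"
  using decay_rate_pos[of p x] by simp

lemma profile_bounds:
  assumes "0 \<le> x" shows "0 < profile x" "profile x \<le> c"
  using c assms by (auto simp: profile_def mult_left_le)

lemma potential_bounds:
  assumes x: "0 \<le> x"
  shows "1 / 2 * (1 / 2 - profile x / 3) \<le> potential p x" "potential p x \<le> 1 / 2 - profile x / 3"
proof -
  have ca: "continuous_on UNIV (\<lambda>\<eta>. a (phase p \<eta>))" by (intro continuous_intros)
  have g: "exp_half_growth 1 (\<lambda>_. 1 / 2)" "exp_half_growth 1 (\<lambda>_. 1)"
    by (auto intro: exp_half_growthI_bounded)
  have "tail_mean c (\<lambda>_. 1 / 2) x \<le> potential p x"
    unfolding potential_def
    by (rule tail_mean_mono[OF c' _ g(1) ca a_growth x]) (rule continuous_on_const a_range)+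
  then show "1 / 2 * (1 / 2 - profile x / 3) \<le> potential p x"
    unfolding tail_mean_const profile_def by simp
  have "potential p x \<le> tail_mean c (\<lambda>_. 1) x"
    unfolding potential_def
    by (rule tail_mean_mono[OF c' ca a_growth _ g(2) x]) (rule continuous_on_const a_range)+
  then show "potential p x \<le> 1 / 2 - profile x / 3"
    unfolding tail_mean_const profile_def by simp
qed

text \<open>The lower bound on the potential decides the maximum in the definition of \<open>rate\<close>.\<close>

lemma decay_rate_sq:
  assumes x: "0 \<le> x"
  shows "(decay_rate p x)\<^sup>2 = 2 * ((profile x)\<^sup>2 / 4 - profile x / 3 + potential p x)"
proof -
  have "(1 - c)\<^sup>2 \<le> (1 - profile x)\<^sup>2"
    using profile_bounds[OF x] c by (intro power_mono) auto
  also have "\<dots> / 4 \<le> (profile x)\<^sup>2 / 4 - profile x / 3 + potential p x"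
    using potential_bounds(1)[OF x, of p] by (simp add: power2_diff field_simps)
  finally have "(1 - c)\<^sup>2 / 4 \<le> (profile x)\<^sup>2 / 4 - profile x / 3 + potential p x" by simp
  then show ?thesis by (simp add: decay_rate_def rate_sq max_def)
qed

lemma decay_rate_le_1:
  assumes x: "0 \<le> x" shows "decay_rate p x \<le> 1"
proof -
  have "profile x * profile x \<le> profile x"
    using profile_bounds[OF x] c by (intro mult_left_le) auto
  moreover have aux: "2 * (q / 4 - u / 3 + j) \<le> 1" if "q \<le> u" "j \<le> 1 / 2 - u / 3" "0 < u" for q u j :: real
    using that by simp
  ultimately have "(decay_rate p x)\<^sup>2 \<le> 1"
    unfolding decay_rate_sq[OF x] using potential_bounds(2)[OF x, of p] profile_bounds(1)[OF x]
    by (intro aux) (auto simp only: power2_eq_square)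
  then show ?thesis using power2_le_imp_le[of "decay_rate p x" 1] by simp
qed

section \<open>Difference quotients in the parameters\<close>

text \<open>For \<open>x \<ge> 0\<close> this is the slope of the chord of \<open>j \<mapsto> 1 / rate x j\<close> between the potentials of two
parameter values.\<close>

definition inverse_rate_chord :: "real \<times> real \<Rightarrow> real \<times> real \<Rightarrow> real \<Rightarrow> real" where
  "inverse_rate_chord p' p x = - 2 / (decay_rate p' x * decay_rate p x * (decay_rate p' x + decay_rate p x))"

lemma inverse_rate_chord_compose [continuous_intros]:
  assumes "continuous_on S f" "continuous_on S g" "continuous_on S h"
  shows "continuous_on S (\<lambda>x. inverse_rate_chord (f x) (g x) (h x))"
  unfolding inverse_rate_chord_def using decay_rate_pos
  by (intro continuous_intros assms) (auto simp: add_pos_pos less_imp_neq[symmetric])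

lemma abs_inverse_rate_chord_le: "\<bar>inverse_rate_chord p' p x\<bar> \<le> lip"
proof -
  have "0 < decay_rate p' x * decay_rate p x * (decay_rate p' x + decay_rate p x)"
    using decay_rate_pos by (intro mult_pos_pos add_pos_pos)
  then have "\<bar>inverse_rate_chord p' p x\<bar> = 2 / (decay_rate p' x * decay_rate p x * (decay_rate p' x + decay_rate p x))"
    by (simp add: inverse_rate_chord_def)
  also have "\<dots> \<le> lip" by (rule inverse_rate_product_le[OF decay_rate_ge decay_rate_ge])
  finally show ?thesis .
qed

lemma inverse_rate_chord_eq:
  assumes "0 \<le> x"
  shows "1 / decay_rate p' x - 1 / decay_rate p x = inverse_rate_chord p' p x * (potential p' x - potential p x)"
proof -
  have "(decay_rate p' x)\<^sup>2 - (decay_rate p x)\<^sup>2 = 2 * (potential p' x - potential p x)"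
    by (simp add: decay_rate_sq[OF assms])
  then show ?thesis unfolding inverse_diff[OF decay_rate_pos decay_rate_pos] inverse_rate_chord_def by (simp add: diff_divide_distrib)
qed

definition chord_along :: "real \<times> real \<Rightarrow> real \<times> real \<Rightarrow> real \<Rightarrow> real" where
  "chord_along p' p \<eta> = chord (phase p' \<eta>) (phase p \<eta>)"

lemma chord_along_compose [continuous_intros]:
  assumes "continuous_on S f" "continuous_on S g" "continuous_on S h"
  shows "continuous_on S (\<lambda>x. chord_along (f x) (g x) (h x))"
  unfolding chord_along_def
  by (intro jointly_continuous_compose[OF jointly_continuous_chord] continuous_intros assms)

lemma abs_chord_along_le: "\<bar>chord_along p' p \<eta>\<bar> \<le> L"
  unfolding chord_along_def by (rule abs_chord_le)

text \<open>The difference quotients of the elapsed time solve a tail equation with the same Lipschitz constants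
as the elapsed time itself, since a chord of a function is never steeper than its Lipschitz constant. The
maps \<open>\<pi>'\<close> and \<open>\<pi>\<close> give the two parameter values; they are the projections of a pair where
continuity is needed, and constants where uniqueness for a fixed pair is needed.\<close>

lemma difference_tail_equation:
  fixes \<pi>' \<pi> :: "'q::metric_space \<Rightarrow> real \<times> real"
  assumes \<pi>: "continuous_on UNIV \<pi>'" "continuous_on UNIV \<pi>"
    and F: "jointly_continuous F" "\<And>q. exp_half_growth B (F q)"
  shows "tail_equation c (L * B) (eps_max * L) lip
    (\<lambda>q \<xi> s. chord_along (\<pi>' q) (\<pi> q) \<xi> * (F q \<xi> + clamp_eps (fst (\<pi> q)) * s))
    (\<lambda>q \<xi> j. inverse_rate_chord (\<pi>' q) (\<pi> q) \<xi> * j)"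
proof
  show "0 \<le> c" "c \<le> 1" "0 \<le> eps_max * L" "0 \<le> lip" "4 * (eps_max * L) * lip \<le> 1"
    using c' L eps_max_pos lip_pos eps_max_small by auto
  have \<pi>f: "continuous_on UNIV (\<lambda>z :: 'q \<times> real \<times> real. \<pi>' (fst z))"
    "continuous_on UNIV (\<lambda>z :: 'q \<times> real \<times> real. \<pi> (fst z))"
    by (rule continuous_on_compose2[OF \<pi>(1)] continuous_on_compose2[OF \<pi>(2)], rule continuous_on_fst[OF continuous_on_id], simp)+
  show "continuous_on UNIV (\<lambda>z. chord_along (\<pi>' (fst z)) (\<pi> (fst z)) (fst (snd z)) *
      (F (fst z) (fst (snd z)) + clamp_eps (fst (\<pi> (fst z))) * snd (snd z)))"
    by (intro continuous_intros \<pi>f jointly_continuous_compose[OF F(1)])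
  show "continuous_on UNIV (\<lambda>z. inverse_rate_chord (\<pi>' (fst z)) (\<pi> (fst z)) (fst (snd z)) * snd (snd z))"
    by (intro continuous_intros \<pi>f)
  show "\<bar>inverse_rate_chord (\<pi>' q) (\<pi> q) \<xi> * s - inverse_rate_chord (\<pi>' q) (\<pi> q) \<xi> * t\<bar> \<le> lip * \<bar>s - t\<bar>" for q \<xi> s t
    unfolding right_diff_distrib[symmetric] abs_mult by (intro mult_right_mono abs_inverse_rate_chord_le) simp
  show "exp_half_growth (L * B) (\<lambda>\<xi>. inverse_rate_chord (\<pi>' q) (\<pi> q) \<xi> * 0)" for q
    using L exp_half_growth_nonneg[OF F(2)] by (intro exp_half_growthI_bounded) auto
  show "\<bar>chord_along (\<pi>' q) (\<pi> q) \<xi> * (F q \<xi> + clamp_eps (fst (\<pi> q)) * s) -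
      chord_along (\<pi>' q) (\<pi> q) \<xi> * (F q \<xi> + clamp_eps (fst (\<pi> q)) * t)\<bar> \<le> eps_max * L * \<bar>s - t\<bar>" for q \<xi> s t
  proof -
    have "chord_along (\<pi>' q) (\<pi> q) \<xi> * (F q \<xi> + clamp_eps (fst (\<pi> q)) * s) -
      chord_along (\<pi>' q) (\<pi> q) \<xi> * (F q \<xi> + clamp_eps (fst (\<pi> q)) * t)
      = clamp_eps (fst (\<pi> q)) * chord_along (\<pi>' q) (\<pi> q) \<xi> * (s - t)"
      by (simp add: algebra_simps)
    moreover have "\<bar>clamp_eps (fst (\<pi> q))\<bar> * \<bar>chord_along (\<pi>' q) (\<pi> q) \<xi>\<bar> * \<bar>s - t\<bar> \<le> eps_max * L * \<bar>s - t\<bar>"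
      using eps_max_pos by (intro mult_mono mult_right_mono abs_clamp_eps abs_chord_along_le) auto
    ultimately show ?thesis by (simp only: abs_mult)
  qed
  show "exp_half_growth (L * B) (\<lambda>\<xi>. chord_along (\<pi>' q) (\<pi> q) \<xi> * (F q \<xi> + clamp_eps (fst (\<pi> q)) * 0))" for q
    unfolding exp_half_growth_def
  proof
    fix \<xi>
    have "\<bar>chord_along (\<pi>' q) (\<pi> q) \<xi>\<bar> * \<bar>F q \<xi>\<bar> \<le> L * (B * exp (\<bar>\<xi>\<bar> / 2))"
      using L by (intro mult_mono abs_chord_along_le exp_half_growthD[OF F(2)]) auto
    then show "\<bar>chord_along (\<pi>' q) (\<pi> q) \<xi> * (F q \<xi> + clamp_eps (fst (\<pi> q)) * 0)\<bar> \<le> L * B * exp (\<bar>\<xi>\<bar> / 2)"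
      by (simp add: abs_mult mult.assoc)
  qed
qed

text \<open>Change of the potential when the phase is perturbed by a forcing \<open>f\<close> and by \<open>\<epsilon>\<close> times a change \<open>s\<close> of
the elapsed time.\<close>

definition response :: "(real \<times> real) \<Rightarrow> (real \<times> real) \<Rightarrow> (real \<Rightarrow> real) \<Rightarrow> (real \<Rightarrow> real) \<Rightarrow> real \<Rightarrow> real" where
  "response p' p f s = tail_mean c (\<lambda>\<eta>. chord_along p' p \<eta> * (f \<eta> + clamp_eps (fst p) * s \<eta>))"

lemma growth_forcing:
  assumes "exp_half_growth B f" "exp_half_growth C s"
  shows "exp_half_growth (L * (B + eps_max * C)) (\<lambda>\<eta>. chord_along p' p \<eta> * (f \<eta> + clamp_eps (fst p) * s \<eta>))"
  unfolding exp_half_growth_def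
proof
  fix \<xi>
  have "\<bar>f \<xi> + clamp_eps (fst p) * s \<xi>\<bar> \<le> \<bar>f \<xi>\<bar> + \<bar>clamp_eps (fst p)\<bar> * \<bar>s \<xi>\<bar>"
    using abs_triangle_ineq[of "f \<xi>" "clamp_eps (fst p) * s \<xi>"] by (simp add: abs_mult)
  also have "\<dots> \<le> B * exp (\<bar>\<xi>\<bar> / 2) + eps_max * (C * exp (\<bar>\<xi>\<bar> / 2))"
    using eps_max_pos by (intro add_mono mult_mono exp_half_growthD assms abs_clamp_eps) auto
  finally have "\<bar>chord_along p' p \<xi>\<bar> * \<bar>f \<xi> + clamp_eps (fst p) * s \<xi>\<bar>
      \<le> L * (B * exp (\<bar>\<xi>\<bar> / 2) + eps_max * (C * exp (\<bar>\<xi>\<bar> / 2)))"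
    using L by (intro mult_mono abs_chord_along_le) auto
  then show "\<bar>chord_along p' p \<xi> * (f \<xi> + clamp_eps (fst p) * s \<xi>)\<bar> \<le> L * (B + eps_max * C) * exp (\<bar>\<xi>\<bar> / 2)"
    unfolding abs_mult by (simp add: distrib_left mult_ac)
qed

lemma response_linear:
  assumes "continuous_on UNIV f" "exp_half_growth B f" "continuous_on UNIV s" "exp_half_growth C s"
    and "continuous_on UNIV g" "exp_half_growth B' g" "continuous_on UNIV t" "exp_half_growth C' t"
  shows "response p' p (\<lambda>\<eta>. u * f \<eta> + v * g \<eta>) (\<lambda>\<eta>. u * s \<eta> + v * t \<eta>) x
    = u * response p' p f s x + v * response p' p g t x"
proof -
  have "response p' p (\<lambda>\<eta>. u * f \<eta> + v * g \<eta>) (\<lambda>\<eta>. u * s \<eta> + v * t \<eta>) x =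
    tail_mean c (\<lambda>\<eta>. u * (chord_along p' p \<eta> * (f \<eta> + clamp_eps (fst p) * s \<eta>)) +
       v * (chord_along p' p \<eta> * (g \<eta> + clamp_eps (fst p) * t \<eta>))) x"
    unfolding response_def by (simp add: algebra_simps)
  also have "\<dots> = u * response p' p f s x + v * response p' p g t x"
    unfolding response_def
    by (rule tail_mean_linear[OF c' _ growth_forcing[OF assms(2,4)] _ growth_forcing[OF assms(6,8)]])
      (intro continuous_intros assms)+
  finally show ?thesis .
qed

lemma linear_response_exists:
  assumes F: "jointly_continuous F" "\<And>z. exp_half_growth B (F z)"
  shows "\<exists>W C. jointly_continuous W \<and> (\<forall>z. exp_half_growth C (W z)) \<and>
    (\<forall>p' p x. W (p', p) x = integral {0..x} (\<lambda>\<xi>. inverse_rate_chord p' p \<xi> * response p' p (F (p', p)) (W (p', p)) \<xi>))"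
proof -
  interpret W: tail_equation c "L * B" "eps_max * L" lip
    "\<lambda>q \<xi> s. chord_along (fst q) (snd q) \<xi> * (F q \<xi> + clamp_eps (fst (snd q)) * s)"
    "\<lambda>q \<xi> j. inverse_rate_chord (fst q) (snd q) \<xi> * j"
    by (rule difference_tail_equation) (auto intro!: continuous_intros F)
  show ?thesis
  proof (rule W.fixed_point_exists)
    fix S C
    assume S: "jointly_continuous S" "\<And>z. exp_half_growth C (S z)" "\<And>z x. S z x = W.step z (S z) x"
    have "S (p', p) x = integral {0..x} (\<lambda>\<xi>. inverse_rate_chord p' p \<xi> * response p' p (F (p', p)) (S (p', p)) \<xi>)" for p' p x
      using S(3)[of "(p', p)" x] unfolding W.step_def W.integrand_def response_def by simp
    with S(1,2) show ?thesis by blast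
  qed
qed

lemma linear_response_unique:
  assumes f: "continuous_on UNIV f" "exp_half_growth B f"
    and s: "continuous_on UNIV s" "exp_half_growth C s"
      "\<And>x. s x = integral {0..x} (\<lambda>\<xi>. inverse_rate_chord p' p \<xi> * response p' p f s \<xi>)"
    and t: "continuous_on UNIV t" "exp_half_growth C' t"
      "\<And>x. t x = integral {0..x} (\<lambda>\<xi>. inverse_rate_chord p' p \<xi> * response p' p f t \<xi>)"
  shows "s x = t x"
proof -
  have "jointly_continuous (\<lambda>_::real. f)"
    by (intro jointly_continuousI continuous_on_compose2[OF f(1)]) (auto intro!: continuous_intros)
  then interpret U: tail_equation c "L * B" "eps_max * L" lip
    "\<lambda>(_::real) \<xi> s. chord_along p' p \<xi> * (f \<xi> + clamp_eps (fst p) * s)"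
    "\<lambda>(_::real) \<xi> j. inverse_rate_chord p' p \<xi> * j"
    using difference_tail_equation[of "\<lambda>_. p'" "\<lambda>_. p" "\<lambda>_. f" B] f(2)
    by (simp add: continuous_on_const)
  have "s x = U.step 0 s x" "t x = U.step 0 t x" for x
    unfolding U.step_def U.integrand_def
    by (rule s(3)[unfolded response_def] t(3)[unfolded response_def])+
  then show ?thesis
    by (rule U.fixed_point_unique[OF s(1,2) _ t(1,2)])
qed

lemma potential_diff:
  "potential p' x - potential p x = response p' p
     (\<lambda>\<eta>. (snd p' - snd p) * 1 + (clamp_eps (fst p') - clamp_eps (fst p)) * elapsed p' \<eta>)
     (\<lambda>\<eta>. elapsed p' \<eta> - elapsed p \<eta>) x"
proof -
  have "tail_mean c (\<lambda>\<eta>. 1 * a (phase p' \<eta>) + (-1) * a (phase p \<eta>)) x = 1 * potential p' x + (-1) * potential p x"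
    unfolding potential_def
    by (rule tail_mean_linear[OF c' _ a_growth _ a_growth]) (intro continuous_intros)+
  moreover have "1 * a (phase p' \<eta>) + (-1) * a (phase p \<eta>) = chord_along p' p \<eta> *
     (((snd p' - snd p) * 1 + (clamp_eps (fst p') - clamp_eps (fst p)) * elapsed p' \<eta>)
      + clamp_eps (fst p) * (elapsed p' \<eta> - elapsed p \<eta>))" for \<eta>
  proof -
    have "phase p' \<eta> - phase p \<eta> = ((snd p' - snd p) * 1 + (clamp_eps (fst p') - clamp_eps (fst p)) * elapsed p' \<eta>)
      + clamp_eps (fst p) * (elapsed p' \<eta> - elapsed p \<eta>)"
      by (simp add: phase_def algebra_simps)
    then show ?thesis
      using chord_mult[of "phase p' \<eta>" "phase p \<eta>"] by (simp add: chord_along_def)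
  qed
  ultimately show ?thesis unfolding response_def by simp
qed

lemma elapsed_diff:
  "elapsed p' x - elapsed p x = integral {0..x} (\<lambda>\<xi>. inverse_rate_chord p' p \<xi> * response p' p
     (\<lambda>\<eta>. (snd p' - snd p) * 1 + (clamp_eps (fst p') - clamp_eps (fst p)) * elapsed p' \<eta>)
     (\<lambda>\<eta>. elapsed p' \<eta> - elapsed p \<eta>) \<xi>)"
proof -
  have "elapsed p' x - elapsed p x = integral {0..x} (\<lambda>\<xi>. 1 / decay_rate p' \<xi> - 1 / decay_rate p \<xi>)"
    unfolding elapsed_eq
    by (intro integral_diff[symmetric] integrable_continuous_interval continuous_intros) auto
  also have "\<dots> = integral {0..x} (\<lambda>\<xi>. inverse_rate_chord p' p \<xi> * (potential p' \<xi> - potential p \<xi>))"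
    by (intro integral_cong inverse_rate_chord_eq) auto
  finally show ?thesis unfolding potential_diff .
qed

text \<open>The phase changes by \<open>\<Delta>y + \<Delta>\<epsilon> T' + \<epsilon> \<Delta>T\<close>. So \<open>\<Delta>T\<close> is the response to the forcing \<open>\<Delta>y + \<Delta>\<epsilon> T'\<close>. Solving
the linear equation for the forcings \<open>1\<close> and \<open>T'\<close> gives \<open>W1\<close> and \<open>W2\<close>, continuous in the pair of
parameters, and uniqueness gives \<open>\<Delta>T = \<Delta>y W1 + \<Delta>\<epsilon> W2\<close>.\<close>

lemma potential_chords:
  obtains \<alpha> \<beta> :: "(real \<times> real) \<times> (real \<times> real) \<Rightarrow> real"
  where "continuous_on UNIV \<alpha>" "continuous_on UNIV \<beta>"
    "\<And>p' p. potential p' 0 - potential p 0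
      = \<alpha> (p', p) * (snd p' - snd p) + \<beta> (p', p) * (clamp_eps (fst p') - clamp_eps (fst p))"
proof -
  obtain B where B: "\<And>p. exp_half_growth B (elapsed p)" using elapsed_growth by blast
  have one: "jointly_continuous (\<lambda>(_ :: (real \<times> real) \<times> (real \<times> real)) _. 1)" "exp_half_growth 1 (\<lambda>_. 1)"
    by (auto intro!: jointly_continuousI exp_half_growthI_bounded)
  have T': "jointly_continuous (\<lambda>z :: (real \<times> real) \<times> (real \<times> real). elapsed (fst z))"
    by (intro jointly_continuousI jointly_continuous_compose[OF jointly_continuous_elapsed] continuous_intros)
  obtain W1 C1 where W1: "jointly_continuous W1" "\<And>z. exp_half_growth C1 (W1 z)"
    "\<And>p' p x. W1 (p', p) x = integral {0..x} (\<lambda>\<xi>. inverse_rate_chord p' p \<xi> * response p' p (\<lambda>_. 1) (W1 (p', p)) \<xi>)"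
    using linear_response_exists[OF one] by blast
  obtain W2 C2 where W2: "jointly_continuous W2" "\<And>z. exp_half_growth C2 (W2 z)"
    "\<And>p' p x. W2 (p', p) x = integral {0..x} (\<lambda>\<xi>. inverse_rate_chord p' p \<xi> * response p' p (elapsed p') (W2 (p', p)) \<xi>)"
    using linear_response_exists[OF T' B, unfolded fst_conv] by blast
  define \<alpha> where "\<alpha> z = response (fst z) (snd z) (\<lambda>_. 1) (W1 z) 0" for z
  define \<beta> where "\<beta> z = response (fst z) (snd z) (elapsed (fst z)) (W2 z) 0" for z
  have ce: "continuous_on S (elapsed p)" for S p
    by (rule jointly_continuous_slice[OF jointly_continuous_elapsed])
  have cw: "continuous_on S (W1 z)" "continuous_on S (W2 z)" for S z
    by (rule jointly_continuous_slice[OF W1(1)] jointly_continuous_slice[OF W2(1)])+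
  have lin: "response p' p (\<lambda>\<eta>. (snd p' - snd p) * 1 + (clamp_eps (fst p') - clamp_eps (fst p)) * elapsed p' \<eta>)
      (\<lambda>\<eta>. (snd p' - snd p) * W1 (p', p) \<eta> + (clamp_eps (fst p') - clamp_eps (fst p)) * W2 (p', p) \<eta>) x
    = (snd p' - snd p) * response p' p (\<lambda>_. 1) (W1 (p', p)) x
      + (clamp_eps (fst p') - clamp_eps (fst p)) * response p' p (elapsed p') (W2 (p', p)) x" for p' p x
    by (rule response_linear[OF _ one(2) cw(1) W1(2) ce B cw(2) W2(2)]) (rule continuous_on_const)
  have cr: "continuous_on UNIV (response p' p f s)"
    if "continuous_on UNIV f" "continuous_on UNIV s" "exp_half_growth D f" "exp_half_growth E s" for p' p f s D E
  proof -
    have "jointly_continuous (\<lambda>_::real. tail_mean c (\<lambda>\<eta>. chord_along p' p \<eta> * (f \<eta> + clamp_eps (fst p) * s \<eta>)))"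
      by (rule jointly_continuous_tail_mean[OF c' _ growth_forcing[OF that(3,4)]])
        (intro jointly_continuousI continuous_intros continuous_on_compose2[OF that(1)]
          continuous_on_compose2[OF that(2)]; simp)
    from jointly_continuous_slice[OF this] show ?thesis unfolding response_def .
  qed
  have W: "elapsed p' x - elapsed p x
    = (snd p' - snd p) * W1 (p', p) x + (clamp_eps (fst p') - clamp_eps (fst p)) * W2 (p', p) x" for p' p x
  proof -
    let ?f = "\<lambda>\<eta>. (snd p' - snd p) * 1 + (clamp_eps (fst p') - clamp_eps (fst p)) * elapsed p' \<eta>"
    let ?s = "\<lambda>\<eta>. elapsed p' \<eta> - elapsed p \<eta>"
    let ?t = "\<lambda>\<eta>. (snd p' - snd p) * W1 (p', p) \<eta> + (clamp_eps (fst p') - clamp_eps (fst p)) * W2 (p', p) \<eta>"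
    have f: "continuous_on UNIV ?f" and s: "continuous_on UNIV ?s" and t: "continuous_on UNIV ?t"
      by (intro continuous_intros ce cw)+
    note fg = exp_half_growth_linear[OF one(2) B[of p'], of "snd p' - snd p" "clamp_eps (fst p') - clamp_eps (fst p)"]
      and tg = exp_half_growth_linear[OF W1(2)[of "(p', p)"] W2(2)[of "(p', p)"],
        of "snd p' - snd p" "clamp_eps (fst p') - clamp_eps (fst p)"]
    have sg: "exp_half_growth (\<bar>1\<bar> * B + \<bar>-1\<bar> * B) ?s"
      using exp_half_growth_linear[OF B[of p'] B[of p], of 1 "-1"] by simp
    note cr1 = cr[OF continuous_on_const cw(1) one(2) W1(2)] and cr2 = cr[OF ce cw(2) B W2(2)]
    have "?t x = integral {0..x} (\<lambda>\<xi>. inverse_rate_chord p' p \<xi> * response p' p ?f ?t \<xi>)" for x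
    proof -
      have "integral {0..x} (\<lambda>\<xi>. inverse_rate_chord p' p \<xi> * response p' p ?f ?t \<xi>) =
        integral {0..x} (\<lambda>\<xi>. (snd p' - snd p) * (inverse_rate_chord p' p \<xi> * response p' p (\<lambda>_. 1) (W1 (p', p)) \<xi>)
          + (clamp_eps (fst p') - clamp_eps (fst p)) * (inverse_rate_chord p' p \<xi> * response p' p (elapsed p') (W2 (p', p)) \<xi>))"
        unfolding lin by (simp add: algebra_simps)
      also have "\<dots> = ?t x"
        unfolding W1(3)[of p' p x] W2(3)[of p' p x]
        by (subst integral_add) (auto intro!: integrable_continuous_interval continuous_intros
            continuous_on_subset[OF cr1] continuous_on_subset[OF cr2])
      finally show ?thesis ..
    qed
    then show ?thesis
      by (rule linear_response_unique[OF f fg s sg elapsed_diff t tg])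
  qed
  have "potential p' 0 - potential p 0
      = \<alpha> (p', p) * (snd p' - snd p) + \<beta> (p', p) * (clamp_eps (fst p') - clamp_eps (fst p))" for p' p
    unfolding potential_diff W lin \<alpha>_def \<beta>_def by (simp add: mult.commute)
  moreover have rc: "jointly_continuous (\<lambda>z. response (fst z) (snd z) (F z) (W z))"
    if "jointly_continuous F" "jointly_continuous W" "\<And>z. exp_half_growth D (F z)" "\<And>z. exp_half_growth E (W z)"
    for F W D E
    unfolding response_def
    by (rule jointly_continuous_tail_mean[OF c' _ growth_forcing[OF that(3,4)]])
      (intro jointly_continuousI continuous_intros jointly_continuous_compose[OF that(1)]
        jointly_continuous_compose[OF that(2)])
  have "continuous_on UNIV \<alpha>"
    unfolding \<alpha>_def
    by (rule jointly_continuous_compose[OF rc[OF one(1) W1(1) one(2) W1(2)] continuous_on_id continuous_on_const])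
  moreover have "continuous_on UNIV \<beta>"
    unfolding \<beta>_def
    by (rule jointly_continuous_compose[OF rc[OF T' W2(1) B W2(2)] continuous_on_id continuous_on_const])
  ultimately show ?thesis using that by blast
qed

end

section \<open>Decaying solutions on a half line\<close>

lemma has_real_derivative_integral_upto:
  fixes f :: "real \<Rightarrow> real"
  assumes f: "continuous_on {0..} f" and x: "0 \<le> x"
  shows "((\<lambda>x. integral {0..x} f) has_real_derivative f x) (at x within {0..})"
proof -
  have "((\<lambda>x. integral {0..x} f) has_real_derivative f x) (at x within {0..x + 1})"
    using x by (intro integral_has_real_derivative continuous_on_subset[OF f]) auto
  moreover have "at x within {0..x + 1} = at x within {0..}"
    by (rule at_within_nhd[of _ "{..<x + 1}"]) auto
  ultimately show ?thesis by simp
qed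

text \<open>A version for one-sided derivatives, which occur at the endpoint of a half line.\<close>

lemma has_real_derivative_inverse_within:
  fixes f g :: "real \<Rightarrow> real"
  assumes f: "(f has_real_derivative D) (at (g y) within S)" and D: "D \<noteq> 0"
    and g: "continuous (at y within T) g" and y: "y \<in> T"
    and inv: "\<And>z. z \<in> T \<Longrightarrow> g z \<in> S" "\<And>z. z \<in> T \<Longrightarrow> f (g z) = z"
  shows "(g has_real_derivative inverse D) (at y within T)"
proof -
  have near: "\<forall>\<^sub>F z in at y within T. z \<in> T \<and> z \<noteq> y"
    by (simp add: eventually_at_filter)
  have "filterlim g (at (g y) within S) (at y within T)"
    unfolding filterlim_at
  proof
    show "\<forall>\<^sub>F z in at y within T. g z \<in> S \<and> g z \<noteq> g y"
      using near by eventually_elim (use inv y in metis)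
    show "(g \<longlongrightarrow> g y) (at y within T)"
      using g by (simp add: continuous_within)
  qed
  from filterlim_compose[OF f[unfolded has_field_derivative_iff] this]
  have "((\<lambda>z. inverse ((f (g z) - f (g y)) / (g z - g y))) \<longlongrightarrow> inverse D) (at y within T)"
    using D by (intro tendsto_inverse)
  moreover have "\<forall>\<^sub>F z in at y within T. inverse ((f (g z) - f (g y)) / (g z - g y)) = (g z - g y) / (z - y)"
    using near by eventually_elim (simp add: inv y)
  ultimately show ?thesis
    unfolding has_field_derivative_iff by (rule Lim_transform_eventually)
qed

context slow_reaction
begin

lemma elapsed_deriv:
  assumes "0 \<le> x"
  shows "(elapsed p has_real_derivative 1 / decay_rate p x) (at x within {0..})"
proof -
  have "continuous_on {0..} (\<lambda>\<xi>. 1 / decay_rate p \<xi>)" by (intro continuous_intros) auto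
  from has_real_derivative_integral_upto[OF this assms] show ?thesis
    unfolding elapsed_eq[symmetric] .
qed

lemma elapsed_0 [simp]: "elapsed p 0 = 0"
  by (simp add: elapsed_eq)

lemma elapsed_diff_bounds:
  assumes x: "0 \<le> x" "x \<le> x'"
  shows "x' - x \<le> elapsed p x' - elapsed p x" "elapsed p x' - elapsed p x \<le> (x' - x) / rate_min"
proof -
  have ci: "(\<lambda>\<xi>. 1 / decay_rate p \<xi>) integrable_on {u..v}" for u v
    by (intro integrable_continuous_interval continuous_intros) auto
  have "integral {0..x} (\<lambda>\<xi>. 1 / decay_rate p \<xi>) + integral {x..x'} (\<lambda>\<xi>. 1 / decay_rate p \<xi>) = integral {0..x'} (\<lambda>\<xi>. 1 / decay_rate p \<xi>)"
    using x by (intro Henstock_Kurzweil_Integration.integral_combine ci) auto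
  then have eq: "elapsed p x' - elapsed p x = integral {x..x'} (\<lambda>\<xi>. 1 / decay_rate p \<xi>)"
    unfolding elapsed_eq by simp
  have "integral {x..x'} (\<lambda>_. 1) \<le> integral {x..x'} (\<lambda>\<xi>. 1 / decay_rate p \<xi>)"
    using x decay_rate_le_1 decay_rate_pos by (intro integral_le ci integrable_const_ivl) (auto simp: le_divide_eq)
  then show "x' - x \<le> elapsed p x' - elapsed p x" using eq x by simp
  have "integral {x..x'} (\<lambda>\<xi>. 1 / decay_rate p \<xi>) \<le> integral {x..x'} (\<lambda>_. 1 / rate_min)"
  proof (intro integral_le ci integrable_const_ivl)
    show "1 / decay_rate p \<xi> \<le> 1 / rate_min" for \<xi>
      using decay_rate_ge[of p \<xi>] decay_rate_pos[of p \<xi>] rate_min by (intro divide_left_mono) auto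
  qed
  then show "elapsed p x' - elapsed p x \<le> (x' - x) / rate_min" using eq x by simp
qed

text \<open>The speed \<open>dx/ds\<close> is at most \<open>1\<close>. Hence the inverse of the elapsed time is nonexpanding, which yields
its joint continuity.\<close>

lemma elapsed_expands:
  assumes "0 \<le> x" "0 \<le> x'"
  shows "\<bar>x' - x\<bar> \<le> \<bar>elapsed p x' - elapsed p x\<bar>"
  using elapsed_diff_bounds(1)[of x x' p] elapsed_diff_bounds(1)[of x' x p] assms
  by (cases "x \<le> x'") auto

text \<open>The inverse function of the elapsed time; the maximum extends it continuously to negative times.\<close>

definition position :: "real \<times> real \<Rightarrow> real \<Rightarrow> real" where
  "position p s = (SOME x. 0 \<le> x \<and> elapsed p x = max 0 s)"

lemma position_nonneg: "0 \<le> position p s"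
  and elapsed_position: "elapsed p (position p s) = max 0 s"
proof -
  have "\<exists>x\<ge>0. x \<le> max 0 s \<and> elapsed p x = max 0 s"
  proof (rule IVT')
    show "elapsed p 0 \<le> max 0 s" by simp
    show "max 0 s \<le> elapsed p (max 0 s)"
      using elapsed_diff_bounds(1)[of 0 "max 0 s" p] by simp
    show "continuous_on {0..max 0 s} (elapsed p)"
      by (rule jointly_continuous_slice[OF jointly_continuous_elapsed])
  qed simp
  then have "\<exists>x. 0 \<le> x \<and> elapsed p x = max 0 s" by blast
  from someI_ex[OF this]
  show "0 \<le> position p s" "elapsed p (position p s) = max 0 s" by (auto simp: position_def)
qed

lemma position_bounds:
  assumes "0 \<le> s"
  shows "rate_min * s \<le> position p s" "position p s \<le> s"
  using elapsed_diff_bounds[of 0 "position p s" p] position_nonneg[of p s] elapsed_position[of p s] assms rate_min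
  by (auto simp: field_simps)

lemma jointly_continuous_position: "jointly_continuous position"
  unfolding jointly_continuous_def continuous_on_eq_continuous_at[OF open_UNIV] isCont_def
proof
  fix w :: "(real \<times> real) \<times> real"
  have "((\<lambda>z. max 0 (snd z) - elapsed (fst z) (position (fst w) (snd w))) \<longlongrightarrow>
      max 0 (snd w) - elapsed (fst w) (position (fst w) (snd w))) (at w)"
  proof -
    have "continuous_on UNIV (\<lambda>z :: (real \<times> real) \<times> real.
        max 0 (snd z) - elapsed (fst z) (position (fst w) (snd w)))"
      by (intro jointly_continuous_compose[OF jointly_continuous_elapsed] continuous_intros)
    then show ?thesis
      unfolding continuous_on_eq_continuous_at[OF open_UNIV] isCont_def by blast
  qed
  then have "((\<lambda>z. max 0 (snd z) - elapsed (fst z) (position (fst w) (snd w))) \<longlongrightarrow> 0) (at w)"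
    by (simp add: elapsed_position)
  then have "((\<lambda>z. \<bar>max 0 (snd z) - elapsed (fst z) (position (fst w) (snd w))\<bar>) \<longlongrightarrow> 0) (at w)"
    by (rule tendsto_rabs_zero)
  then have "((\<lambda>z. position (fst z) (snd z) - position (fst w) (snd w)) \<longlongrightarrow> 0) (at w)"
  proof (rule Lim_null_comparison[rotated], intro always_eventually allI)
    fix z :: "(real \<times> real) \<times> real"
    show "norm (position (fst z) (snd z) - position (fst w) (snd w))
        \<le> \<bar>max 0 (snd z) - elapsed (fst z) (position (fst w) (snd w))\<bar>"
      using elapsed_expands[OF position_nonneg position_nonneg, of "fst z" "snd z" "fst w" "snd w" "fst z"]
      by (simp add: elapsed_position)
  qed
  then show "((\<lambda>z. position (fst z) (snd z)) \<longlongrightarrow> position (fst w) (snd w)) (at w)"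
    by (simp add: LIM_zero_iff)
qed

lemma position_deriv:
  assumes s: "0 \<le> s"
  shows "(position p has_real_derivative decay_rate p (position p s)) (at s within {0..})"
proof -
  have "(position p has_real_derivative inverse (1 / decay_rate p (position p s))) (at s within {0..})"
  proof (rule has_real_derivative_inverse_within[OF elapsed_deriv])
    show "continuous (at s within {0..}) (position p)"
      using jointly_continuous_slice[OF jointly_continuous_position, of "{0..}" p] s
      by (simp add: continuous_on_eq_continuous_within)
  qed (use s in \<open>auto simp: position_nonneg elapsed_position\<close>)
  then show ?thesis by simp
qed

text \<open>The energy identity: \<open>v^2 rate^2 = v'^2\<close>, whose derivative with respect to \<open>v\<close> is \<open>2 v''\<close>; the remaining
factor is \<open>dv/dx = - v\<close>.\<close>

lemma profile_decay_rate_sq_deriv: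
  assumes x: "0 \<le> x"
  shows "((\<lambda>x. (profile x)\<^sup>2 * (decay_rate p x)\<^sup>2) has_real_derivative
    2 * profile x * (profile x * (profile x - a (phase p x)) * (1 - profile x))) (at x within {0..})"
proof -
  let ?k = "tail_kernel c (\<lambda>\<eta>. a (phase p \<eta>))"
  let ?I = "\<lambda>x. integral {0..exp (- x)} ?k"
  have ck: "continuous_on {0..} ?k"
    by (rule continuous_tail_kernel1[OF c' _ a_growth]) (intro continuous_intros)
  have "((\<lambda>z. integral {0..z} ?k) has_real_derivative ?k (exp (- x))) (at (exp (- x)) within {0..})"
    by (rule has_real_derivative_integral_upto[OF ck]) simp
  then have "((\<lambda>z. integral {0..z} ?k) has_real_derivative ?k (exp (- x))) (at (exp (- x)) within (\<lambda>x. exp (- x)) ` {0..})"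
    by (rule DERIV_subset) auto
  moreover have "((\<lambda>x. exp (- x)) has_real_derivative - exp (- x)) (at x within {0..})"
    by (auto intro!: derivative_eq_intros)
  ultimately have "(((\<lambda>z. integral {0..z} ?k) \<circ> (\<lambda>x. exp (- x))) has_real_derivative ?k (exp (- x)) * (- exp (- x))) (at x within {0..})"
    by (rule DERIV_image_chain)
  then have I: "(?I has_real_derivative ?k (exp (- x)) * (- exp (- x))) (at x within {0..})"
    by (simp add: o_def)
  have P: "(profile has_real_derivative - profile x) (at x within {0..})"
    unfolding profile_def by (auto intro!: derivative_eq_intros)
  have eq: "(profile x)\<^sup>2 * (decay_rate p x)\<^sup>2 = (profile x) ^ 4 / 2 - 2 * (profile x) ^ 3 / 3 + 2 * c\<^sup>2 * ?I x" if "0 \<le> x" for x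
  proof -
    have "(profile x)\<^sup>2 * exp (2 * x) = c\<^sup>2"
      by (simp add: profile_def power_mult_distrib flip: exp_of_nat_mult exp_add)
    then have "(profile x)\<^sup>2 * potential p x = c\<^sup>2 * ?I x"
      unfolding potential_def tail_mean_def by (simp add: mult.assoc[symmetric])
    moreover have "u\<^sup>2 * (2 * (u\<^sup>2 / 4 - u / 3 + j)) = u ^ 4 / 2 - 2 * u ^ 3 / 3 + 2 * (u\<^sup>2 * j)" for u j :: real
      by (simp add: field_simps power2_eq_square power3_eq_cube power4_eq_xxxx)
    ultimately show ?thesis unfolding decay_rate_sq[OF that] by (simp only: mult.assoc)
  qed
  have "((\<lambda>x. (profile x) ^ 4 / 2 - 2 * (profile x) ^ 3 / 3 + 2 * c\<^sup>2 * ?I x) has_real_derivative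
     4 * (profile x) ^ 3 * (- profile x) / 2 - 2 * (3 * (profile x)\<^sup>2 * (- profile x)) / 3
      + 2 * c\<^sup>2 * (?k (exp (- x)) * (- exp (- x)))) (at x within {0..})"
    by (rule derivative_eq_intros P I refl | simp)+
  moreover have "4 * (profile x) ^ 3 * (- profile x) / 2 - 2 * (3 * (profile x)\<^sup>2 * (- profile x)) / 3
      + 2 * c\<^sup>2 * (?k (exp (- x)) * (- exp (- x)))
    = 2 * profile x * (profile x * (profile x - a (phase p x)) * (1 - profile x))"
    by (simp add: tail_kernel_def profile_def field_simps power2_eq_square power3_eq_cube power4_eq_xxxx)
  ultimately have D: "((\<lambda>x. (profile x) ^ 4 / 2 - 2 * (profile x) ^ 3 / 3 + 2 * c\<^sup>2 * ?I x) has_real_derivative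
      2 * profile x * (profile x * (profile x - a (phase p x)) * (1 - profile x))) (at x within {0..})"
    by (simp only:)
  show ?thesis
    by (rule has_field_derivative_transform_within[OF D zero_less_one]) (use x eq in auto)
qed

definition sol :: "real \<times> real \<Rightarrow> real \<Rightarrow> real" where
  "sol p s = profile (position p s)"

definition vel :: "real \<times> real \<Rightarrow> real \<Rightarrow> real" where
  "vel p s = - (sol p s * decay_rate p (position p s))"

lemma position_compose [continuous_intros]:
  "continuous_on S f \<Longrightarrow> continuous_on S g \<Longrightarrow> continuous_on S (\<lambda>x. position (f x) (g x))"
  by (rule jointly_continuous_compose[OF jointly_continuous_position])

lemma jointly_continuous_sol: "jointly_continuous sol"
  unfolding sol_def profile_def by (intro jointly_continuousI continuous_intros)

lemma jointly_continuous_vel: "jointly_continuous vel"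
  unfolding vel_def
  by (intro jointly_continuousI continuous_intros jointly_continuous_compose[OF jointly_continuous_sol])

lemma sol_pos: "0 < sol p s"
  using profile_bounds(1)[OF position_nonneg] by (simp add: sol_def)

lemma vel_neg: "vel p s < 0"
  using sol_pos decay_rate_pos by (simp add: vel_def)

lemma position_0 [simp]: "position p 0 = 0"
  using position_bounds[of 0 p] by simp

lemma sol_0: "sol p 0 = c"
  by (simp add: sol_def profile_def)

lemma sol_less:
  assumes "0 < s" shows "sol p s < c"
proof -
  have "0 < position p s"
    using position_bounds(1)[of s p] assms rate_min mult_pos_pos[of rate_min s] by linarith
  then show ?thesis using c by (simp add: sol_def profile_def)
qed

lemma sol_decay:
  assumes "0 \<le> s" shows "sol p s \<le> exp (- (rate_min * s))"
proof -
  have "sol p s \<le> 1 * exp (- position p s)"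
    unfolding sol_def profile_def using c by (intro mult_right_mono) auto
  also have "\<dots> \<le> exp (- (rate_min * s))"
    using position_bounds(1)[OF assms, of p] by simp
  finally show ?thesis .
qed

lemma vel_decay:
  assumes "0 \<le> s" shows "\<bar>vel p s\<bar> \<le> exp (- (rate_min * s))"
proof -
  have "\<bar>vel p s\<bar> = sol p s * decay_rate p (position p s)"
    using vel_neg[of p s] by (simp add: vel_def)
  also have "\<dots> \<le> sol p s"
    using decay_rate_le_1[OF position_nonneg] sol_pos[of p s] by (intro mult_left_le) auto
  also note sol_decay[OF assms]
  finally show ?thesis .
qed

lemma sol_deriv:
  assumes s: "0 \<le> s"
  shows "(sol p has_real_derivative vel p s) (at s within {0..})"
  unfolding sol_def[abs_def] profile_def
  by (rule derivative_eq_intros position_deriv[OF s] refl | simp add: vel_def sol_def profile_def)+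

text \<open>The velocity is recovered as the negative square root of its square, to which the energy identity
applies.\<close>

lemma vel_deriv:
  assumes s: "0 \<le> s" and p: "\<bar>fst p\<bar> \<le> eps_max"
  shows "(vel p has_real_derivative - (sol p s * (sol p s - a (fst p * s + snd p)) * (1 - sol p s))) (at s within {0..})"
proof -
  let ?G = "\<lambda>x. (profile x)\<^sup>2 * (decay_rate p x)\<^sup>2"
  let ?f = "sol p s * (sol p s - a (fst p * s + snd p)) * (1 - sol p s)"
  have ph: "phase p (position p s) = fst p * s + snd p"
    using s p by (simp add: phase_def elapsed_position clamp_eps_id)
  have "(?G has_real_derivative 2 * sol p s * ?f) (at (position p s) within {0..})"
    using profile_decay_rate_sq_deriv[OF position_nonneg, of p p s] by (simp add: ph sol_def)
  then have "(?G has_real_derivative 2 * sol p s * ?f) (at (position p s) within position p ` {0..})"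
    by (rule DERIV_subset) (auto simp: position_nonneg)
  from DERIV_image_chain[OF this position_deriv[OF s]]
  have "((\<lambda>s. ?G (position p s)) has_real_derivative 2 * sol p s * ?f * decay_rate p (position p s)) (at s within {0..})"
    by (simp add: o_def)
  moreover have vs: "?G (position p s) = (vel p s)\<^sup>2" for s
    by (simp add: vel_def sol_def power_mult_distrib)
  ultimately have sq: "((\<lambda>s. (vel p s)\<^sup>2) has_real_derivative - 2 * vel p s * ?f) (at s within {0..})"
    by (simp add: vel_def mult_ac)
  have rt: "(sqrt has_real_derivative inverse (sqrt ((vel p s)\<^sup>2)) / 2) (at ((vel p s)\<^sup>2))"
    using vel_neg[of p s] by (intro DERIV_real_sqrt) simp
  have "((\<lambda>s. - sqrt ((vel p s)\<^sup>2)) has_real_derivative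
      - (inverse (sqrt ((vel p s)\<^sup>2)) / 2 * (- 2 * vel p s * ?f))) (at s within {0..})"
    by (rule DERIV_minus[OF DERIV_chain2[OF rt sq]])
  moreover have "- sqrt ((vel p s)\<^sup>2) = vel p s" for s
    using vel_neg[of p s] by simp
  moreover have "- (inverse (sqrt ((vel p s)\<^sup>2)) / 2 * (- 2 * vel p s * ?f)) = - ?f"
    using vel_neg[of p s] by (simp add: field_simps)
  ultimately show ?thesis by simp
qed

lemma vel_0_sq: "(vel p 0)\<^sup>2 = c\<^sup>2 * (2 * (c\<^sup>2 / 4 - c / 3 + potential p 0))"
  by (simp add: vel_def sol_0 power_mult_distrib decay_rate_sq) (simp add: profile_def)

text \<open>For \<open>\<epsilon> = 0\<close> the phase is constant.\<close>

lemma potential_at_eps_0: "potential (0, y) 0 = a y * (1 / 2 - c / 3)"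
proof -
  have "clamp_eps 0 = 0" using eps_max_pos by (simp add: clamp_eps_id)
  then show ?thesis
    using tail_mean_const[of c "a y" 0] by (simp add: potential_def phase_def)
qed

end

section \<open>Implicit functions from chords, and slow modulation\<close>

lemma dist_Pair_le: "dist (a, b) (a', b') \<le> dist a a' + dist b b'"
  unfolding dist_Pair_Pair by (rule sqrt_sum_squares_le_sum) auto

text \<open>In a box around \<open>(0, y0)\<close> the slope \<open>\<alpha>\<close> is at least half its value at the centre, and \<open>\<beta>\<close> is bounded. So
for small \<open>e\<close> there is a sign change in \<open>y\<close>. For two zeros the chord identity becomes
\<open>\<alpha> \<Delta>y + \<beta> \<Delta>e = 0\<close>: the difference quotient of the zero is exactly \<open>- \<beta> / \<alpha>\<close>, and by continuity it
converges to the derivative.\<close>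

lemma chord_implicit_function_pos:
  fixes \<Delta> :: "real \<times> real \<Rightarrow> real" and \<alpha> \<beta> :: "(real \<times> real) \<times> (real \<times> real) \<Rightarrow> real"
  assumes cont: "continuous_on UNIV \<alpha>" "continuous_on UNIV \<beta>" and E: "0 < E"
    and chords: "\<And>p' p. \<bar>fst p'\<bar> \<le> E \<Longrightarrow> \<bar>fst p\<bar> \<le> E \<Longrightarrow>
      \<Delta> p' - \<Delta> p = \<alpha> (p', p) * (snd p' - snd p) + \<beta> (p', p) * (fst p' - fst p)"
    and zero: "\<Delta> (0, y0) = 0" and pos: "0 < \<alpha> ((0, y0), (0, y0))"
  shows "\<exists>e0>0. \<exists>ybar. e0 \<le> E \<and> ybar C1_differentiable_on {0<..<e0} \<and> (ybar \<longlongrightarrow> y0) (at_right 0) \<and>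
    (\<forall>e\<in>{0<..<e0}. \<Delta> (e, ybar e) = 0)"
proof -
  define z0 where "z0 = ((0 :: real, y0), (0 :: real, y0))"
  define m where "m = \<alpha> z0 / 2"
  define B where "B = \<bar>\<beta> z0\<bar> + 1"
  have m: "0 < m" and B: "0 < B" using pos by (auto simp: m_def B_def z0_def)
  have "isCont \<alpha> z0" "isCont \<beta> z0"
    using cont unfolding continuous_on_eq_continuous_at[OF open_UNIV] by blast+
  then have ed: "\<forall>e>0. \<exists>d>0. \<forall>z. dist z z0 < d \<longrightarrow> dist (\<alpha> z) (\<alpha> z0) < e"
    "\<forall>e>0. \<exists>d>0. \<forall>z. dist z z0 < d \<longrightarrow> dist (\<beta> z) (\<beta> z0) < e"
    unfolding continuous_at_eps_delta .
  obtain d1 where d1: "0 < d1" "\<forall>z. dist z z0 < d1 \<longrightarrow> dist (\<alpha> z) (\<alpha> z0) < m"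
    using ed(1)[rule_format, OF m] by blast
  obtain d2 where d2: "0 < d2" "\<forall>z. dist z z0 < d2 \<longrightarrow> dist (\<beta> z) (\<beta> z0) < 1"
    using ed(2)[rule_format, OF zero_less_one] by blast
  note d = d1(1) d2(1) d1(2)[rule_format] d2(2)[rule_format]
  \<comment> \<open>A fifth, because the four coordinates of a pair of points can each contribute \<open>r\<close> to the distance.\<close>
  define r where "r = min E (min d1 d2 / 5)"
  have r: "0 < r" "r \<le> E" using E d by (auto simp: r_def)
  have near: "m \<le> \<alpha> ((e', y'), (e, y))" "\<bar>\<beta> ((e', y'), (e, y))\<bar> \<le> B"
    if "\<bar>e'\<bar> \<le> r" "\<bar>e\<bar> \<le> r" "\<bar>y' - y0\<bar> \<le> r" "\<bar>y - y0\<bar> \<le> r" for e' y' e y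
  proof -
    let ?z = "((e', y'), (e, y))"
    have "dist ?z z0 \<le> dist e' 0 + dist y' y0 + (dist e 0 + dist y y0)"
      unfolding z0_def by (intro order_trans[OF dist_Pair_le] add_mono dist_Pair_le)
    also have "\<dots> \<le> 4 * r" using that by (simp add: dist_real_def)
    also have "\<dots> < 5 * r" using r by simp
    also have "\<dots> \<le> min d1 d2" using min.cobounded2[of E "min d1 d2 / 5"] unfolding r_def by linarith
    finally have "dist ?z z0 < d1" "dist ?z z0 < d2" by auto
    then have "dist (\<alpha> ?z) (\<alpha> z0) < m" "dist (\<beta> ?z) (\<beta> z0) < 1" using d by blast+
    then show "m \<le> \<alpha> ?z" "\<bar>\<beta> ?z\<bar> \<le> B"
      unfolding dist_real_def m_def B_def by linarith+
  qed
  \<comment> \<open>For \<open>e < e0\<close> the term with \<open>\<beta>\<close> is smaller than \<open>m r\<close> and cannot change the sign at \<open>y0 \<plusminus> r\<close>.\<close>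
  define e0 where "e0 = min r (m * r / B)"
  have e0: "0 < e0" "e0 \<le> r" "B * e0 \<le> m * r"
    using r m B by (auto simp: e0_def min_def field_simps)
  have "\<exists>y. \<bar>y - y0\<bar> \<le> r \<and> \<Delta> (e, y) = 0" if e: "0 < e" "e < e0" for e
  proof -
    have ee: "\<bar>e\<bar> \<le> r" "\<bar>e\<bar> \<le> E" using e e0 r by auto
    have "\<bar>\<beta> ((e, y), (0, y0)) * e\<bar> < m * r" if "\<bar>y - y0\<bar> \<le> r" for y
    proof -
      have "\<bar>\<beta> ((e, y), (0, y0)) * e\<bar> \<le> B * e"
        unfolding abs_mult using near(2)[of e 0 y y0] ee that r e by (intro mult_mono) auto
      also have "\<dots> < B * e0" using e B by simp
      finally show ?thesis using e0 by simp
    qed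
    from this[of "y0 + r"] this[of "y0 - r"]
    have b: "\<bar>\<beta> ((e, y0 + r), (0, y0)) * e\<bar> < m * r" "\<bar>\<beta> ((e, y0 - r), (0, y0)) * e\<bar> < m * r"
      using r by auto
    have "m * r \<le> \<alpha> ((e, y0 + r), (0, y0)) * r" "m * r \<le> \<alpha> ((e, y0 - r), (0, y0)) * r"
      using near(1)[of e 0 "y0 + r" y0] near(1)[of e 0 "y0 - r" y0] ee r by (auto intro!: mult_right_mono)
    then have lo: "\<Delta> (e, y0 - r) \<le> 0" and hi: "0 \<le> \<Delta> (e, y0 + r)"
      using chords[of "(e, y0 + r)" "(0, y0)"] chords[of "(e, y0 - r)" "(0, y0)"] b ee E zero by auto
    have eq: "\<Delta> (e, y) = \<Delta> (e, y0) + \<alpha> ((e, y), (e, y0)) * (y - y0)" for y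
      using chords[of "(e, y)" "(e, y0)"] ee by simp
    have "continuous_on {y0 - r..y0 + r} (\<lambda>y. \<Delta> (e, y0) + \<alpha> ((e, y), (e, y0)) * (y - y0))"
      by (intro continuous_intros continuous_on_compose2[OF cont(1)]) auto
    then have "continuous_on {y0 - r..y0 + r} (\<lambda>y. \<Delta> (e, y))"
      unfolding eq[symmetric] .
    from IVT'[OF lo hi _ this] r obtain y where "y0 - r \<le> y" "y \<le> y0 + r" "\<Delta> (e, y) = 0" by auto
    then show ?thesis by (intro exI[of _ y]) auto
  qed
  then obtain ybar where ybar: "\<And>e. 0 < e \<Longrightarrow> e < e0 \<Longrightarrow> \<bar>ybar e - y0\<bar> \<le> r \<and> \<Delta> (e, ybar e) = 0"
    by metis
  define z where "z e' e = ((e', ybar e'), (e, ybar e))" for e' e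
  have zb: "m \<le> \<alpha> (z e' e)" "\<bar>\<beta> (z e' e)\<bar> \<le> B" if "e' \<in> {0<..<e0}" "e \<in> {0<..<e0}" for e' e
    using near[of e' e "ybar e'" "ybar e"] ybar[of e] ybar[of e'] that e0 by (auto simp: z_def)
  have slope: "ybar e' - ybar e = - \<beta> (z e' e) / \<alpha> (z e' e) * (e' - e)"
    if "e' \<in> {0<..<e0}" "e \<in> {0<..<e0}" for e' e
  proof -
    have "\<alpha> (z e' e) * (ybar e' - ybar e) + \<beta> (z e' e) * (e' - e) = 0"
      using chords[of "(e', ybar e')" "(e, ybar e)"] ybar[of e] ybar[of e'] that e0 r by (auto simp: z_def)
    then show ?thesis using zb(1)[OF that] m by (simp add: field_simps eq_neg_iff_add_eq_0)
  qed
  have bound: "\<bar>ybar e' - ybar e\<bar> \<le> B / m * \<bar>e' - e\<bar>" if "e' \<in> {0<..<e0}" "e \<in> {0<..<e0}" for e' e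
  proof -
    have "\<bar>\<beta> (z e' e)\<bar> / \<alpha> (z e' e) \<le> B / m"
      using zb[OF that] m B by (intro frac_le) auto
    then have "\<bar>\<beta> (z e' e)\<bar> / \<alpha> (z e' e) * \<bar>e' - e\<bar> \<le> B / m * \<bar>e' - e\<bar>"
      by (intro mult_right_mono) auto
    then show ?thesis
      unfolding slope[OF that] abs_mult abs_divide abs_minus_cancel using zb(1)[OF that] m by simp
  qed
  have yc: "continuous_on {0<..<e0} ybar"
  proof (rule lipschitz_on_continuous_on)
    show "(B / m)-lipschitz_on {0<..<e0} ybar"
      using bound B m by (intro lipschitz_onI) (auto simp: dist_real_def)
  qed
  have zc: "continuous_on {0<..<e0} (\<lambda>e'. \<phi> (z e' e))" "continuous_on {0<..<e0} (\<lambda>e. \<phi> (z e e))"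
    if "continuous_on UNIV \<phi>" for \<phi> :: "(real \<times> real) \<times> (real \<times> real) \<Rightarrow> real" and e
    unfolding z_def by (intro continuous_on_compose2[OF that] continuous_intros yc; simp)+
  have deriv: "(ybar has_real_derivative - \<beta> (z e e) / \<alpha> (z e e)) (at e)" if e: "e \<in> {0<..<e0}" for e
  proof -
    have "continuous_on {0<..<e0} (\<lambda>e'. - \<beta> (z e' e) / \<alpha> (z e' e))"
      using zb(1)[OF _ e] m by (intro continuous_intros zc cont) force
    then have "((\<lambda>e'. - \<beta> (z e' e) / \<alpha> (z e' e)) \<longlongrightarrow> - \<beta> (z e e) / \<alpha> (z e e)) (at e)"
      using e by (simp add: continuous_on_eq_continuous_at isCont_def)
    moreover have "\<forall>\<^sub>F e' in at e. - \<beta> (z e' e) / \<alpha> (z e' e) = (ybar e' - ybar e) / (e' - e)"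
    proof -
      have "\<forall>\<^sub>F e' in at e. e' \<in> {0<..<e0} - {e}"
        using e by (intro eventually_at_in_open) auto
      then show ?thesis by eventually_elim (use slope e in auto)
    qed
    ultimately show ?thesis
      unfolding has_field_derivative_iff by (rule Lim_transform_eventually)
  qed
  have "ybar C1_differentiable_on {0<..<e0}"
    unfolding C1_differentiable_on_def
  proof (intro exI conjI ballI)
    show "(ybar has_vector_derivative - \<beta> (z e e) / \<alpha> (z e e)) (at e)" if "e \<in> {0<..<e0}" for e
      using deriv[OF that] by (simp add: has_real_derivative_iff_has_vector_derivative)
    show "continuous_on {0<..<e0} (\<lambda>e. - \<beta> (z e e) / \<alpha> (z e e))"
      using zb(1) m by (intro continuous_intros zc cont) force
  qed
  moreover have "(ybar \<longlongrightarrow> y0) (at_right 0)"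
  proof -
    have ev: "\<forall>\<^sub>F e in at_right 0. e \<in> {0<..<e0}"
      by (rule eventually_at_right_real[OF e0(1)])
    have "\<forall>\<^sub>F e in at_right 0. norm (ybar e - y0) \<le> B / m * e"
      using ev
    proof eventually_elim
      case (elim e)
      let ?w = "((e, ybar e), (0, y0))"
      have w: "m \<le> \<alpha> ?w" "\<bar>\<beta> ?w\<bar> \<le> B"
        using near[of e 0 "ybar e" y0] ybar[of e] elim e0 by auto
      have eq: "\<alpha> ?w * (ybar e - y0) = - \<beta> ?w * e"
        using chords[of "(e, ybar e)" "(0, y0)"] ybar[of e] elim e0 r zero by auto
      have "\<alpha> ?w * \<bar>ybar e - y0\<bar> = \<bar>\<beta> ?w\<bar> * e"
        using arg_cong[of _ _ abs, OF eq] w(1) m elim by (simp add: abs_mult)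
      moreover have "m * \<bar>ybar e - y0\<bar> \<le> \<alpha> ?w * \<bar>ybar e - y0\<bar>" "\<bar>\<beta> ?w\<bar> * e \<le> B * e"
        using w elim by (auto intro!: mult_right_mono)
      ultimately have "m * \<bar>ybar e - y0\<bar> \<le> B * e" by simp
      then have "\<bar>ybar e - y0\<bar> \<le> B * e / m" using m by (simp add: pos_le_divide_eq mult.commute)
      then show ?case using m by (simp only: real_norm_def times_divide_eq_left)
    qed
    moreover have "((\<lambda>e. B / m * e) \<longlongrightarrow> 0) (at_right 0)"
      using m by (auto intro!: tendsto_eq_intros)
    ultimately have "((\<lambda>e. ybar e - y0) \<longlongrightarrow> 0) (at_right 0)"
      by (rule Lim_null_comparison)
    then show ?thesis by (simp add: LIM_zero_iff)
  qed
  ultimately show ?thesis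
    using e0 r ybar by (intro exI[of _ e0] conjI exI[of _ ybar]) auto
qed

text \<open>On the diagonal \<open>\<alpha>\<close> is the partial derivative with respect to \<open>y\<close>.\<close>

lemma chord_implicit_function:
  fixes \<Delta> :: "real \<times> real \<Rightarrow> real" and \<alpha> \<beta> :: "(real \<times> real) \<times> (real \<times> real) \<Rightarrow> real"
  assumes cont: "continuous_on UNIV \<alpha>" "continuous_on UNIV \<beta>" and E: "0 < E"
    and chords: "\<And>p' p. \<bar>fst p'\<bar> \<le> E \<Longrightarrow> \<bar>fst p\<bar> \<le> E \<Longrightarrow>
      \<Delta> p' - \<Delta> p = \<alpha> (p', p) * (snd p' - snd p) + \<beta> (p', p) * (fst p' - fst p)"
    and zero: "\<Delta> (0, y0) = 0" and deriv: "((\<lambda>y. \<Delta> (0, y)) has_real_derivative d) (at y0)" "d \<noteq> 0"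
  shows "\<exists>e0>0. \<exists>ybar. e0 \<le> E \<and> ybar C1_differentiable_on {0<..<e0} \<and> (ybar \<longlongrightarrow> y0) (at_right 0) \<and>
    (\<forall>e\<in>{0<..<e0}. \<Delta> (e, ybar e) = 0)"
proof -
  have "((\<lambda>y. \<alpha> ((0, y), (0, y0))) \<longlongrightarrow> \<alpha> ((0, y0), (0, y0))) (at y0)"
  proof -
    have "continuous_on UNIV (\<lambda>y. \<alpha> ((0, y), (0, y0)))"
      by (intro continuous_on_compose2[OF cont(1)] continuous_intros) auto
    then show ?thesis by (simp add: continuous_on_eq_continuous_at isCont_def)
  qed
  moreover have "\<forall>\<^sub>F y in at y0. \<alpha> ((0, y), (0, y0)) = (\<Delta> (0, y) - \<Delta> (0, y0)) / (y - y0)"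
    using chords[of "(0, y)" "(0, y0)" for y] E by (auto simp: eventually_at_filter)
  ultimately have "((\<lambda>y. (\<Delta> (0, y) - \<Delta> (0, y0)) / (y - y0)) \<longlongrightarrow> \<alpha> ((0, y0), (0, y0))) (at y0)"
    by (rule Lim_transform_eventually)
  with deriv(1) have d: "\<alpha> ((0, y0), (0, y0)) = d"
    unfolding has_field_derivative_iff by (intro tendsto_unique[of "at y0"]) auto
  show ?thesis
  proof (cases "0 < d")
    case True
    with d show ?thesis by (intro chord_implicit_function_pos[OF cont E chords zero]) auto
  next
    case False
    have "\<exists>e0>0. \<exists>ybar. e0 \<le> E \<and> ybar C1_differentiable_on {0<..<e0} \<and> (ybar \<longlongrightarrow> y0) (at_right 0) \<and>
      (\<forall>e\<in>{0<..<e0}. - \<Delta> (e, ybar e) = 0)"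
    proof (rule chord_implicit_function_pos[of "\<lambda>z. - \<alpha> z" "\<lambda>z. - \<beta> z"])
      show "- \<Delta> p' - - \<Delta> p = - \<alpha> (p', p) * (snd p' - snd p) + - \<beta> (p', p) * (fst p' - fst p)"
        if "\<bar>fst p'\<bar> \<le> E" "\<bar>fst p\<bar> \<le> E" for p' p
        using chords[OF that] by simp
    qed (use False deriv(2) d cont E zero in \<open>auto intro!: continuous_intros\<close>)
    then show ?thesis by simp
  qed
qed

lemma exp_decay_at_top:
  fixes \<kappa> \<delta> :: real
  assumes \<kappa>: "0 < \<kappa>" and \<delta>: "0 < \<delta>"
  shows "\<forall>\<^sub>F s in at_top. exp (- (\<kappa> * s)) < \<delta>"
proof -
  have "filterlim (\<lambda>s. \<kappa> * s) at_top at_top"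
    by (rule filterlim_tendsto_pos_mult_at_top[OF tendsto_const \<kappa> filterlim_ident])
  then have "((\<lambda>s. exp (- (\<kappa> * s))) \<longlongrightarrow> 0) at_top"
    by (intro filterlim_compose[OF exp_at_bot] filterlim_compose[OF filterlim_uminus_at_bot_at_top])
  from order_tendstoD(2)[OF this \<delta>] show ?thesis .
qed

lemma SUP_abs_tendsto_0:
  fixes g :: "'e \<Rightarrow> 't \<Rightarrow> real"
  assumes S: "S \<noteq> {}" and g: "\<And>\<delta>. 0 < \<delta> \<Longrightarrow> \<forall>\<^sub>F e in F. \<forall>t\<in>S. \<bar>g e t\<bar> \<le> \<delta>"
  shows "((\<lambda>e. SUP t\<in>S. \<bar>g e t\<bar>) \<longlongrightarrow> 0) F"
proof (rule tendstoI)
  fix \<delta> :: real assume "0 < \<delta>"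
  then have "\<forall>\<^sub>F e in F. \<forall>t\<in>S. \<bar>g e t\<bar> \<le> \<delta> / 2" by (intro g) simp
  then show "\<forall>\<^sub>F e in F. dist (SUP t\<in>S. \<bar>g e t\<bar>) 0 < \<delta>"
  proof eventually_elim
    case (elim e)
    obtain t where t: "t \<in> S" using S by blast
    have "bdd_above ((\<lambda>t. \<bar>g e t\<bar>) ` S)" using elim by (intro bdd_aboveI2[of S _ "\<delta> / 2"]) auto
    from cSUP_upper[OF t this] have "0 \<le> (SUP t\<in>S. \<bar>g e t\<bar>)"
      by (rule order_trans[rotated]) simp
    moreover have "(SUP t\<in>S. \<bar>g e t\<bar>) \<le> \<delta> / 2"
      using elim S by (intro cSUP_least) auto
    ultimately show ?case using \<open>0 < \<delta>\<close> by (simp add: dist_real_def)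
  qed
qed

text \<open>Long times are covered by the decay. On \<open>[0, s0]\<close> both parameter values, \<open>(\<sigma> e, ybar e)\<close> and
\<open>(0, \<sigma> e s + ybar e)\<close>, tend to \<open>(0, y0)\<close> uniformly in \<open>s\<close>, and \<open>f\<close> is uniformly continuous on compact sets.\<close>

lemma slow_modulation:
  fixes f :: "real \<times> real \<Rightarrow> real \<Rightarrow> real"
  assumes f: "jointly_continuous f" and \<kappa>: "0 < \<kappa>"
    and decay: "\<And>p s. 0 \<le> s \<Longrightarrow> \<bar>f p s\<bar> \<le> exp (- (\<kappa> * s))"
    and ybar: "(ybar \<longlongrightarrow> y0) (at_right 0)" and \<sigma>: "\<bar>\<sigma>\<bar> \<le> 1" and \<delta>: "0 < \<delta>"
  shows "\<forall>\<^sub>F e in at_right 0. \<forall>s\<ge>0. \<bar>f (\<sigma> * e, ybar e) s - f (0, \<sigma> * e * s + ybar e) s\<bar> \<le> \<delta>"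
proof -
  \<comment> \<open>From \<open>s0\<close> on each of the two values is at most \<open>\<delta> / 2\<close> in modulus.\<close>
  define s0 where "s0 = max 0 (ln (2 / \<delta>) / \<kappa>)"
  have s0: "0 \<le> s0" by (simp add: s0_def)
  have tail: "exp (- (\<kappa> * s)) \<le> \<delta> / 2" if "s0 \<le> s" for s
  proof -
    have "ln (2 / \<delta>) / \<kappa> \<le> s" using that by (simp add: s0_def)
    then have "ln (2 / \<delta>) \<le> \<kappa> * s" using \<kappa> by (simp add: field_simps)
    then have "exp (- (\<kappa> * s)) \<le> exp (- ln (2 / \<delta>))" by simp
    also have "\<dots> = \<delta> / 2" using \<delta> by (simp add: exp_minus)
    finally show ?thesis .
  qed
  let ?K = "({-1 :: real..1} \<times> {y0 - 2..y0 + 2}) \<times> {0..s0}"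
  have "compact ?K" by (intro compact_Times compact_Icc)
  moreover have "continuous_on ?K (\<lambda>z. f (fst z) (snd z))"
    using f unfolding jointly_continuous_def by (rule continuous_on_subset) auto
  ultimately have "uniformly_continuous_on ?K (\<lambda>z. f (fst z) (snd z))"
    by (intro compact_uniformly_continuous)
  then obtain d where d: "0 < d"
    "\<And>z z'. z \<in> ?K \<Longrightarrow> z' \<in> ?K \<Longrightarrow> dist z' z < d \<Longrightarrow> dist (f (fst z') (snd z')) (f (fst z) (snd z)) < \<delta>"
    unfolding uniformly_continuous_on_def using \<delta> by blast
  \<comment> \<open>For \<open>e < b\<close> the parameter values differ by at most \<open>e (s0 + 1) < d\<close> and stay in the compact set.\<close>
  define b where "b = min 1 d / (s0 + 1)"
  have b: "0 < b" using d s0 by (simp add: b_def)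
  have "\<forall>\<^sub>F e in at_right 0. dist (ybar e) y0 < 1" by (rule tendstoD[OF ybar zero_less_one])
  moreover have "\<forall>\<^sub>F e in at_right 0. e \<in> {0<..<b}" by (rule eventually_at_right_real[OF b])
  ultimately show ?thesis
  proof eventually_elim
    case (elim e)
    have small: "e * (s0 + 1) < 1" "e * (s0 + 1) < d"
    proof -
      have "e * (s0 + 1) < b * (s0 + 1)" using elim s0 by (intro mult_strict_right_mono) auto
      also have "\<dots> = min 1 d" using s0 by (simp add: b_def)
      finally show "e * (s0 + 1) < 1" "e * (s0 + 1) < d" by auto
    qed
    show ?case
    proof (intro allI impI)
      fix s :: real assume s: "0 \<le> s"
      show "\<bar>f (\<sigma> * e, ybar e) s - f (0, \<sigma> * e * s + ybar e) s\<bar> \<le> \<delta>"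
      proof (cases "s \<le> s0")
        case False
        then show ?thesis
          using decay[OF s, of "(\<sigma> * e, ybar e)"] decay[OF s, of "(0, \<sigma> * e * s + ybar e)"] tail[of s] by linarith
      next
        case True
        have e1: "\<bar>\<sigma> * e\<bar> \<le> e" using \<sigma> elim by (auto simp: abs_mult intro: mult_left_le_one_le)
        have e2: "\<bar>\<sigma> * e * s\<bar> \<le> e * s0"
          unfolding abs_mult[of "\<sigma> * e" s] using e1 s True elim by (intro mult_mono) auto
        have e3: "e + e * s0 = e * (s0 + 1)" by (simp add: algebra_simps)
        have "0 \<le> e * s0" "0 \<le> e" using elim s0 by auto
        have "dist ((\<sigma> * e, ybar e), s) ((0, \<sigma> * e * s + ybar e), s)
            \<le> dist (\<sigma> * e) 0 + dist (ybar e) (\<sigma> * e * s + ybar e) + dist s s"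
          by (intro order_trans[OF dist_Pair_le] add_mono dist_Pair_le order_refl)
        also have "\<dots> \<le> e + e * s0" using e1 e2 by (simp add: dist_real_def)
        also have "\<dots> < d" using small e3 by simp
        finally have "dist ((\<sigma> * e, ybar e), s) ((0, \<sigma> * e * s + ybar e), s) < d" .
        moreover have "((\<sigma> * e, ybar e), s) \<in> ?K" "((0, \<sigma> * e * s + ybar e), s) \<in> ?K"
        proof -
          have "\<bar>\<sigma> * e\<bar> \<le> 1" "\<bar>\<sigma> * e * s\<bar> \<le> 1" "\<bar>ybar e - y0\<bar> < 1"
            using e1 e2 e3 small elim \<open>0 \<le> e * s0\<close> \<open>0 \<le> e\<close> by (auto simp: dist_real_def)
          then show "((\<sigma> * e, ybar e), s) \<in> ?K" "((0, \<sigma> * e * s + ybar e), s) \<in> ?K"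
            using s True by (simp_all only: mem_Times_iff atLeastAtMost_iff fst_conv snd_conv; intro conjI TrueI; linarith)+
        qed
        ultimately have "dist (f (\<sigma> * e, ybar e) s) (f (0, \<sigma> * e * s + ybar e) s) < \<delta>"
          using d(2)[of "((0, \<sigma> * e * s + ybar e), s)" "((\<sigma> * e, ybar e), s)"] by simp
        then show ?thesis by (simp add: dist_real_def)
      qed
    qed
  qed
qed

section \<open>The switched equation\<close>

lemma C1_differentiable_on_UNIV_deriv:
  fixes f :: "real \<Rightarrow> real"
  assumes "f C1_differentiable_on UNIV"
  shows "(f has_real_derivative deriv f x) (at x)" "continuous_on UNIV (deriv f)"
proof -
  obtain D where D: "\<And>x. (f has_real_derivative D x) (at x)" "continuous_on UNIV D"
    using assms unfolding C1_differentiable_on_def has_real_derivative_iff_has_vector_derivative by blast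
  then have "deriv f = D" by (intro ext DERIV_imp_deriv)
  with D show "(f has_real_derivative deriv f x) (at x)" "continuous_on UNIV (deriv f)" by auto
qed

lemma dot_eq:
  assumes "(u has_real_derivative D) (at t within S)" "at t within S \<noteq> bot"
  shows "dot S u t = D"
  unfolding dot_def using assms
  by (intro vector_derivative_within) (auto simp: has_real_derivative_iff_has_vector_derivative)

lemma at_within_half_line_neq_bot:
  fixes t :: real
  shows "t \<le> 0 \<Longrightarrow> at t within {..0} \<noteq> bot" "0 \<le> t \<Longrightarrow> at t within {0..} \<noteq> bot"
proof -
  have "{..0} \<noteq> {x}" "{0..} \<noteq> {x}" for x :: real
  proof -
    have "-1 \<in> {..0 :: real}" "-2 \<in> {..0 :: real}" "1 \<in> {0 :: real..}" "2 \<in> {0 :: real..}" by auto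
    then show "{..0} \<noteq> {x}" "{0..} \<noteq> {x}" by (metis singletonD neg_equal_iff_equal one_eq_numeral_iff semiring_norm(85))+
  qed
  then have "t \<le> 0 \<Longrightarrow> t islimpt {..0}" "0 \<le> t \<Longrightarrow> t islimpt {0..}"
    by (auto intro!: connected_imp_perfect)
  then show "t \<le> 0 \<Longrightarrow> at t within {..0} \<noteq> bot" "0 \<le> t \<Longrightarrow> at t within {0..} \<noteq> bot"
    by (auto simp: trivial_limit_within)
qed

lemma C1_solutionI:
  assumes ne: "\<And>t. t \<in> S \<Longrightarrow> at t within S \<noteq> bot"
    and u: "\<And>t. t \<in> S \<Longrightarrow> (u has_real_derivative v t) (at t within S)" and v: "continuous_on S v"
    and lo: "\<And>t. t \<in> S \<Longrightarrow> u t < c \<Longrightarrow>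
      (v has_real_derivative - (u t * (u t - am (\<epsilon> * t + y)) * (1 - u t))) (at t within S)"
    and hi: "\<And>t. t \<in> S \<Longrightarrow> c < u t \<Longrightarrow>
      (v has_real_derivative - (u t * (u t - ap (\<epsilon> * t + y)) * (1 - u t))) (at t within S)"
  shows "C1_solution c am ap \<epsilon> y S u"
proof -
  have d: "dot S u t = v t" if "t \<in> S" for t
    using dot_eq[OF u[OF that] ne[OF that]] .
  have tr: "(dot S u has_real_derivative D) (at t within S)"
    if "t \<in> S" "(v has_real_derivative D) (at t within S)" for t D
    by (rule has_field_derivative_transform_within[OF that(2) zero_less_one that(1)]) (simp add: d)
  show "C1_solution c am ap \<epsilon> y S u"
    unfolding C1_solution_def
  proof (intro conjI ballI impI)
    show "u differentiable_on S"
      using u unfolding differentiable_on_def by (meson field_differentiable_def field_differentiable_imp_differentiable)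
    show "continuous_on S (dot S u)"
      using v d by (simp cong: continuous_on_cong)
  qed (use tr lo hi in auto)
qed

lemma C1_solution_bounds:
  assumes sol: "C1_solution c am ap \<epsilon> y S u" and t: "t \<in> S" "at t within S \<noteq> bot"
    and u: "0 \<le> u t" "u t \<le> 1" and v: "\<bar>dot S u t\<bar> \<le> 1"
    and a: "\<And>z. 0 \<le> am z" "\<And>z. am z \<le> 1" "\<And>z. 0 \<le> ap z" "\<And>z. ap z \<le> 1"
  shows "\<bar>u t\<bar> \<le> 1 \<and> \<bar>dot S u t\<bar> \<le> 1 \<and> (u t \<noteq> c \<longrightarrow> \<bar>dot S (dot S u) t\<bar> \<le> 1)"
proof (intro conjI impI)
  have rhs: "\<bar>- (u t * (u t - A) * (1 - u t))\<bar> \<le> 1" if "0 \<le> A" "A \<le> 1" for A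
  proof -
    have "\<bar>u t\<bar> * \<bar>u t - A\<bar> * \<bar>1 - u t\<bar> \<le> 1 * 1 * 1"
      using u that by (intro mult_mono) auto
    then show ?thesis by (simp add: abs_mult)
  qed
  assume "u t \<noteq> c"
  then consider "u t < c" | "c < u t" by linarith
  then show "\<bar>dot S (dot S u) t\<bar> \<le> 1"
  proof cases
    case 1
    then have "dot S (dot S u) t = - (u t * (u t - am (\<epsilon> * t + y)) * (1 - u t))"
      using sol t by (intro dot_eq) (auto simp: C1_solution_def)
    then show ?thesis using rhs[OF a(1,2)] by simp
  next
    case 2
    then have "dot S (dot S u) t = - (u t * (u t - ap (\<epsilon> * t + y)) * (1 - u t))"
      using sol t by (intro dot_eq) (auto simp: C1_solution_def)
    then show ?thesis using rhs[OF a(3,4)] by simp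
  qed
qed (use u v in auto)

lemma has_real_derivative_reflect:
  assumes "(f has_real_derivative D) (at (- t) within {0..})"
  shows "((\<lambda>t. f (- t)) has_real_derivative - D) (at t within {..0})"
proof -
  have im: "uminus ` {..0} = {0 :: real..}" by simp
  have "(uminus has_real_derivative - 1) (at t within {..0})"
    by (auto intro!: derivative_eq_intros)
  from DERIV_image_chain[OF _ this, unfolded im, OF assms]
  show ?thesis by (simp add: o_def)
qed

text \<open>Since each assumption is conditional, this covers points on either side as well as the junction.\<close>

lemma has_real_derivative_glue:
  fixes f g :: "real \<Rightarrow> real"
  assumes neg: "t \<le> 0 \<Longrightarrow> (f has_real_derivative D) (at t within {..0})"
    and pos: "0 \<le> t \<Longrightarrow> (g has_real_derivative D) (at t within {0..})"
    and eq: "f 0 = g 0"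
  shows "((\<lambda>t. if t \<le> 0 then f t else g t) has_real_derivative D) (at t)"
proof -
  let ?h = "\<lambda>t. if t \<le> 0 then f t else g t"
  have n: "(?h has_real_derivative D) (at t within {..0})" if "t \<le> 0"
    by (rule has_field_derivative_transform_within[OF neg zero_less_one]) (use that in auto)
  have p: "(?h has_real_derivative D) (at t within {0..})" if "0 \<le> t"
    by (rule has_field_derivative_transform_within[OF pos zero_less_one]) (use that eq in auto)
  consider "t < 0" | "t = 0" | "0 < t" by linarith
  then show ?thesis
  proof cases
    case 1 then show ?thesis using n at_within_interior[of t "{..0}"] by simp
  next
    case 2
    have "(?h has_real_derivative D) (at t within {..0} \<union> {0..})"
      using n p 2 unfolding has_field_derivative_iff Lim_within_Un by simp
    moreover have "{..0} \<union> {0..} = (UNIV :: real set)" by auto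
    ultimately show ?thesis by simp
  next
    case 3 then show ?thesis using p at_within_interior[of t "{0..}"] by simp
  qed
qed

locale switched_reaction =
  fixes am am' ap ap' :: "real \<Rightarrow> real" and c L :: real
  assumes c: "0 < c" "c < 1" and L: "0 \<le> L"
    and am: "\<And>y. (am has_real_derivative am' y) (at y)" "continuous_on UNIV am'" "\<And>y. \<bar>am' y\<bar> \<le> L"
    and ap: "\<And>y. (ap has_real_derivative ap' y) (at y)" "continuous_on UNIV ap'" "\<And>y. \<bar>ap' y\<bar> \<le> L"
    and am_range: "\<And>y. 1 / 2 \<le> am y" "\<And>y. am y \<le> 1"
    and ap_range: "\<And>y. 0 \<le> ap y" "\<And>y. ap y \<le> 1 / 2"

sublocale switched_reaction \<subseteq> M: slow_reaction am am' c L
  by unfold_locales (use c L am am_range in auto)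

sublocale switched_reaction \<subseteq> P: slow_reaction "\<lambda>y. 1 - ap y" "\<lambda>y. - ap' y" "1 - c" L
proof unfold_locales
  show "((\<lambda>y. 1 - ap y) has_real_derivative - ap' y) (at y)" for y
    using ap(1)[of y] by (auto intro!: derivative_eq_intros)
  show "1 / 2 \<le> 1 - ap y" for y using ap_range(2)[of y] by simp
qed (use c L ap ap_range in \<open>auto intro!: continuous_intros\<close>)

context switched_reaction
begin

lemma a_range: "0 \<le> am z" "am z \<le> 1" "0 \<le> ap z" "ap z \<le> 1"
  using am_range[of z] ap_range[of z] by auto

text \<open>Reversing time turns the phase \<open>\<epsilon> t + y\<close> into \<open>- \<epsilon> s + y\<close>, hence the sign of the first parameter.\<close>

definition left :: "real \<times> real \<Rightarrow> real \<Rightarrow> real" where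
  "left p t = M.sol (- fst p, snd p) (- t)"

definition left_vel :: "real \<times> real \<Rightarrow> real \<Rightarrow> real" where
  "left_vel p t = - M.vel (- fst p, snd p) (- t)"

text \<open>If \<open>v\<close> solves \<open>v'' = - v (v - (1 - A)) (1 - v)\<close> then \<open>u = 1 - v\<close> solves \<open>u'' = - u (u - A) (1 - u)\<close>; and
\<open>A \<le> 1 / 2\<close> becomes \<open>1 - A \<ge> 1 / 2\<close>.\<close>

definition right :: "real \<times> real \<Rightarrow> real \<Rightarrow> real" where
  "right p t = 1 - P.sol p t"

definition right_vel :: "real \<times> real \<Rightarrow> real \<Rightarrow> real" where
  "right_vel p t = - P.vel p t"

definition eps_bound :: real where "eps_bound = min M.eps_max P.eps_max"

lemma eps_bound: "0 < eps_bound" "eps_bound \<le> M.eps_max" "eps_bound \<le> P.eps_max"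
  using M.eps_max_pos P.eps_max_pos by (auto simp: eps_bound_def)

lemma left_0: "left p 0 = c" and right_0: "right p 0 = c"
  by (simp_all add: left_def right_def M.sol_0 P.sol_0)

lemma left_less: "t < 0 \<Longrightarrow> left p t < c"
  by (simp add: left_def M.sol_less)

lemma right_greater: "0 < t \<Longrightarrow> c < right p t"
  using P.sol_less[of t p] by (simp add: right_def)

lemma left_range: assumes "t \<le> 0" shows "0 \<le> left p t" "left p t \<le> 1"
  using M.sol_pos[of "(- fst p, snd p)" "- t"] left_less[of t p] left_0[of p] c assms
  by (auto simp: left_def le_less)

lemma right_range: assumes "0 \<le> t" shows "0 \<le> right p t" "right p t \<le> 1"
  using P.sol_pos[of p t] right_greater[of t p] right_0[of p] c assms
  by (auto simp: right_def le_less)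

lemma left_vel_le: assumes "t \<le> 0" shows "\<bar>left_vel p t\<bar> \<le> 1"
proof -
  have "\<bar>left_vel p t\<bar> \<le> exp (- (M.rate_min * - t))"
    using M.vel_decay[of "- t"] assms by (simp add: left_vel_def)
  also have "\<dots> \<le> 1" using assms M.rate_min by (simp add: mult_nonneg_nonpos)
  finally show ?thesis .
qed

lemma right_vel_le: assumes "0 \<le> t" shows "\<bar>right_vel p t\<bar> \<le> 1"
proof -
  have "\<bar>right_vel p t\<bar> \<le> exp (- (P.rate_min * t))"
    using P.vel_decay[of t] assms by (simp add: right_vel_def)
  also have "\<dots> \<le> 1" using assms P.rate_min by simp
  finally show ?thesis .
qed

lemma left_deriv:
  assumes "t \<le> 0"
  shows "(left p has_real_derivative left_vel p t) (at t within {..0})"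
  unfolding left_def[abs_def] left_vel_def
  by (rule has_real_derivative_reflect[OF M.sol_deriv]) (use assms in simp)

lemma left_vel_deriv:
  assumes "t \<le> 0" "\<bar>fst p\<bar> \<le> eps_bound"
  shows "(left_vel p has_real_derivative - (left p t * (left p t - am (fst p * t + snd p)) * (1 - left p t)))
    (at t within {..0})"
  using DERIV_minus[OF has_real_derivative_reflect[OF M.vel_deriv[of "- t" "(- fst p, snd p)"]]] assms eps_bound
  by (simp add: left_def left_vel_def[abs_def])

lemma right_deriv:
  assumes "0 \<le> t"
  shows "(right p has_real_derivative right_vel p t) (at t within {0..})"
  unfolding right_def[abs_def] right_vel_def
  using P.sol_deriv[OF assms, of p] by (auto intro!: derivative_eq_intros)

lemma right_vel_deriv:
  assumes "0 \<le> t" "\<bar>fst p\<bar> \<le> eps_bound"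
  shows "(right_vel p has_real_derivative - (right p t * (right p t - ap (fst p * t + snd p)) * (1 - right p t)))
    (at t within {0..})"
proof -
  have "(right_vel p has_real_derivative
      - (- (P.sol p t * (P.sol p t - (1 - ap (fst p * t + snd p))) * (1 - P.sol p t)))) (at t within {0..})"
    unfolding right_vel_def[abs_def]
    using assms eps_bound by (intro DERIV_minus P.vel_deriv) auto
  then show ?thesis by (simp add: right_def algebra_simps)
qed

lemma continuous_left_vel: "continuous_on S (left_vel p)"
  unfolding left_vel_def
  by (intro continuous_intros jointly_continuous_compose[OF M.jointly_continuous_vel])

lemma continuous_right_vel: "continuous_on S (right_vel p)"
  unfolding right_vel_def
  by (intro continuous_intros jointly_continuous_compose[OF P.jointly_continuous_vel])

lemma left_solution:
  assumes e: "\<bar>\<epsilon>\<bar> \<le> eps_bound"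
  shows "C1_solution c am ap \<epsilon> y {..0} (left (\<epsilon>, y))" "\<And>t. t \<le> 0 \<Longrightarrow> dot {..0} (left (\<epsilon>, y)) t = left_vel (\<epsilon>, y) t"
proof -
  have nhi: "\<not> c < left (\<epsilon>, y) t" if "t \<in> {..0}" for t
    using left_less[of t "(\<epsilon>, y)"] left_0[of "(\<epsilon>, y)"] that by (cases "t = 0") auto
  have deriv: "(left (\<epsilon>, y) has_real_derivative left_vel (\<epsilon>, y) t) (at t within {..0})"
    "(left_vel (\<epsilon>, y) has_real_derivative
      - (left (\<epsilon>, y) t * (left (\<epsilon>, y) t - am (\<epsilon> * t + y)) * (1 - left (\<epsilon>, y) t))) (at t within {..0})"
    "at t within {..0} \<noteq> bot" if "t \<in> {..0}" for t
    using left_deriv[of t "(\<epsilon>, y)"] left_vel_deriv[of t "(\<epsilon>, y)"] at_within_half_line_neq_bot that e by auto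
  show "C1_solution c am ap \<epsilon> y {..0} (left (\<epsilon>, y))"
    by (rule C1_solutionI[OF deriv(3,1) continuous_left_vel deriv(2)]) (use nhi in auto)
  show "dot {..0} (left (\<epsilon>, y)) t = left_vel (\<epsilon>, y) t" if "t \<le> 0" for t
    by (rule dot_eq[OF deriv(1,3)]) (use that in auto)
qed

lemma right_solution:
  assumes e: "\<bar>\<epsilon>\<bar> \<le> eps_bound"
  shows "C1_solution c am ap \<epsilon> y {0..} (right (\<epsilon>, y))" "\<And>t. 0 \<le> t \<Longrightarrow> dot {0..} (right (\<epsilon>, y)) t = right_vel (\<epsilon>, y) t"
proof -
  have nlo: "\<not> right (\<epsilon>, y) t < c" if "t \<in> {0..}" for t
    using right_greater[of t "(\<epsilon>, y)"] right_0[of "(\<epsilon>, y)"] that by (cases "t = 0") auto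
  have deriv: "(right (\<epsilon>, y) has_real_derivative right_vel (\<epsilon>, y) t) (at t within {0..})"
    "(right_vel (\<epsilon>, y) has_real_derivative
      - (right (\<epsilon>, y) t * (right (\<epsilon>, y) t - ap (\<epsilon> * t + y)) * (1 - right (\<epsilon>, y) t))) (at t within {0..})"
    "at t within {0..} \<noteq> bot" if "t \<in> {0..}" for t
    using right_deriv[of t "(\<epsilon>, y)"] right_vel_deriv[of t "(\<epsilon>, y)"] at_within_half_line_neq_bot that e by auto
  show "C1_solution c am ap \<epsilon> y {0..} (right (\<epsilon>, y))"
    by (rule C1_solutionI[OF deriv(3,1) continuous_right_vel _ deriv(2)]) (use nlo in auto)
  show "dot {0..} (right (\<epsilon>, y)) t = right_vel (\<epsilon>, y) t" if "0 \<le> t" for t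
    by (rule dot_eq[OF deriv(1,3)]) (use that in auto)
qed

definition glued :: "real \<times> real \<Rightarrow> real \<Rightarrow> real" where
  "glued p t = (if t \<le> 0 then left p t else right p t)"

definition glued_vel :: "real \<times> real \<Rightarrow> real \<Rightarrow> real" where
  "glued_vel p t = (if t \<le> 0 then left_vel p t else right_vel p t)"

text \<open>The two halves may have different second derivatives at \<open>t = 0\<close>, but there the solution equals \<open>c\<close> and the
equation imposes nothing.\<close>

lemma glued_solution:
  assumes e: "\<bar>\<epsilon>\<bar> \<le> eps_bound" and match: "left_vel (\<epsilon>, y) 0 = right_vel (\<epsilon>, y) 0"
  shows "C1_solution c am ap \<epsilon> y UNIV (glued (\<epsilon>, y))" "dot UNIV (glued (\<epsilon>, y)) t = glued_vel (\<epsilon>, y) t"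
proof -
  let ?p = "(\<epsilon>, y)"
  have eq: "left ?p 0 = right ?p 0" by (simp add: left_0 right_0)
  have deriv: "(glued ?p has_real_derivative glued_vel ?p t) (at t)" for t
    unfolding glued_def[abs_def]
    by (rule has_real_derivative_glue)
      (use left_deriv[of t ?p] right_deriv[of t ?p] match eq in \<open>auto simp: glued_vel_def le_less\<close>)
  have cont: "continuous_on UNIV (glued_vel ?p)"
  proof -
    have "continuous_on ({..0} \<union> {0..}) (glued_vel ?p)"
      unfolding glued_vel_def[abs_def]
      by (rule continuous_on_cases) (use match continuous_left_vel continuous_right_vel in auto)
    moreover have "{..0} \<union> {0..} = (UNIV :: real set)" by auto
    ultimately show ?thesis by simp
  qed
  have second: "(glued_vel ?p has_real_derivative D) (at t)"
    if "t < 0 \<Longrightarrow> (left_vel ?p has_real_derivative D) (at t within {..0})"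
      "0 < t \<Longrightarrow> (right_vel ?p has_real_derivative D) (at t within {0..})" "t \<noteq> 0" for t D
    unfolding glued_vel_def[abs_def]
    by (rule has_real_derivative_glue) (use that match in \<open>auto simp: le_less\<close>)
  have lo: "(glued_vel ?p has_real_derivative - (glued ?p t * (glued ?p t - am (\<epsilon> * t + y)) * (1 - glued ?p t))) (at t)"
    if "glued ?p t < c" for t
  proof -
    have "t < 0"
      using that left_0[of ?p] right_greater[of t ?p] by (cases "t = 0") (auto simp: glued_def split: if_splits)
    then show ?thesis
      using left_vel_deriv[of t ?p] e by (intro second) (auto simp: glued_def)
  qed
  have hi: "(glued_vel ?p has_real_derivative - (glued ?p t * (glued ?p t - ap (\<epsilon> * t + y)) * (1 - glued ?p t))) (at t)"
    if "c < glued ?p t" for t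
  proof -
    have "0 < t"
      using that left_0[of ?p] left_less[of t ?p] by (cases "t = 0") (auto simp: glued_def split: if_splits)
    then show ?thesis
      using right_vel_deriv[of t ?p] e by (intro second) (auto simp: glued_def)
  qed
  show "C1_solution c am ap \<epsilon> y UNIV (glued ?p)"
    by (rule C1_solutionI[OF _ deriv cont lo hi]) auto
  show "dot UNIV (glued ?p) t = glued_vel ?p t"
    by (rule dot_eq[OF deriv]) simp
qed

text \<open>Squares, because the squared velocities are affine in the potentials. Both velocities are positive, so
that nothing is lost.\<close>

definition gap :: "real \<times> real \<Rightarrow> real" where
  "gap p = (right_vel p 0)\<^sup>2 - (left_vel p 0)\<^sup>2"

lemma gap_0_iff: "gap p = 0 \<longleftrightarrow> left_vel p 0 = right_vel p 0"
proof -
  have "0 < left_vel p 0" "0 < right_vel p 0"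
    using M.vel_neg P.vel_neg by (auto simp: left_vel_def right_vel_def)
  then show ?thesis
    by (auto simp: gap_def intro: power2_eq_imp_eq)
qed

text \<open>The energies are explicit here: with \<open>F(A) = c^4 / 4 - (1 + A) c^3 / 3 + A c^2 / 2\<close>, the squared velocities
are \<open>2 F(am y)\<close> on the left and \<open>2 (F(ap y) + (1 - 2 ap y) / 12)\<close> on the right.\<close>

lemma gap_at_eps_0: "gap (0, y) = - D_fun c am ap y / 3"
  unfolding gap_def left_vel_def right_vel_def power2_minus fst_conv snd_conv minus_zero
    M.vel_0_sq P.vel_0_sq M.potential_at_eps_0 P.potential_at_eps_0 D_fun_def
  by (simp add: field_simps power2_eq_square)

lemma gap_chords:
  obtains \<alpha> \<beta> :: "(real \<times> real) \<times> (real \<times> real) \<Rightarrow> real"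
  where "continuous_on UNIV \<alpha>" "continuous_on UNIV \<beta>"
    "\<And>p' p. \<bar>fst p'\<bar> \<le> eps_bound \<Longrightarrow> \<bar>fst p\<bar> \<le> eps_bound \<Longrightarrow>
      gap p' - gap p = \<alpha> (p', p) * (snd p' - snd p) + \<beta> (p', p) * (fst p' - fst p)"
proof -
  obtain \<alpha>M \<beta>M where M: "continuous_on UNIV \<alpha>M" "continuous_on UNIV \<beta>M"
    "\<And>p' p. M.potential p' 0 - M.potential p 0
      = \<alpha>M (p', p) * (snd p' - snd p) + \<beta>M (p', p) * (M.clamp_eps (fst p') - M.clamp_eps (fst p))"
    by (rule M.potential_chords) blast
  obtain \<alpha>P \<beta>P where P: "continuous_on UNIV \<alpha>P" "continuous_on UNIV \<beta>P"
    "\<And>p' p. P.potential p' 0 - P.potential p 0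
      = \<alpha>P (p', p) * (snd p' - snd p) + \<beta>P (p', p) * (P.clamp_eps (fst p') - P.clamp_eps (fst p))"
    by (rule P.potential_chords) blast
  define n :: "real \<times> real \<Rightarrow> real \<times> real" where "n p = (- fst p, snd p)" for p
  define \<alpha> where "\<alpha> z = 2 * (1 - c)\<^sup>2 * \<alpha>P z - 2 * c\<^sup>2 * \<alpha>M (n (fst z), n (snd z))" for z
  define \<beta> where "\<beta> z = 2 * (1 - c)\<^sup>2 * \<beta>P z + 2 * c\<^sup>2 * \<beta>M (n (fst z), n (snd z))" for z
  have "continuous_on UNIV \<alpha>" "continuous_on UNIV \<beta>"
    unfolding \<alpha>_def \<beta>_def n_def
    by (intro continuous_intros M P continuous_on_compose2[OF M(1)] continuous_on_compose2[OF M(2)]; simp)+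
  moreover have "gap p' - gap p = \<alpha> (p', p) * (snd p' - snd p) + \<beta> (p', p) * (fst p' - fst p)"
    if "\<bar>fst p'\<bar> \<le> eps_bound" "\<bar>fst p\<bar> \<le> eps_bound" for p' p
  proof -
    have "gap p' - gap p = 2 * (1 - c)\<^sup>2 * (P.potential p' 0 - P.potential p 0)
        - 2 * c\<^sup>2 * (M.potential (n p') 0 - M.potential (n p) 0)"
      unfolding gap_def left_vel_def right_vel_def power2_minus minus_zero M.vel_0_sq P.vel_0_sq n_def[symmetric]
      by (simp add: algebra_simps)
    also have "P.potential p' 0 - P.potential p 0 = \<alpha>P (p', p) * (snd p' - snd p) + \<beta>P (p', p) * (fst p' - fst p)"
      using P(3)[of p' p] that eps_bound by (simp add: P.clamp_eps_id)
    also have "M.potential (n p') 0 - M.potential (n p) 0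
        = \<alpha>M (n p', n p) * (snd p' - snd p) - \<beta>M (n p', n p) * (fst p' - fst p)"
      using M(3)[of "n p'" "n p"] that eps_bound by (simp add: M.clamp_eps_id n_def algebra_simps)
    finally show ?thesis by (simp add: \<alpha>_def \<beta>_def algebra_simps)
  qed
  ultimately show ?thesis using that by blast
qed

section \<open>Fronts and their persistence\<close>

lemma abs_0_le_eps_bound: "\<bar>0\<bar> \<le> eps_bound"
  using eps_bound by simp

lemma bounded_left: "bounded_with_derivs c {..0} UNIV (\<lambda>t y. left (0, y) t)"
  unfolding bounded_with_derivs_def
proof (intro exI[of _ 1] ballI)
  fix y t :: real assume "t \<in> {..0}"
  then show "\<bar>left (0, y) t\<bar> \<le> 1 \<and> \<bar>dot {..0} (left (0, y)) t\<bar> \<le> 1 \<and>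
      (left (0, y) t \<noteq> c \<longrightarrow> \<bar>dot {..0} (dot {..0} (left (0, y))) t\<bar> \<le> 1)"
    by (intro C1_solution_bounds[OF left_solution(1)[OF abs_0_le_eps_bound]])
      (auto simp: left_range a_range at_within_half_line_neq_bot
        left_solution(2)[OF abs_0_le_eps_bound] left_vel_le)
qed

lemma bounded_right: "bounded_with_derivs c {0..} UNIV (\<lambda>t y. right (0, y) t)"
  unfolding bounded_with_derivs_def
proof (intro exI[of _ 1] ballI)
  fix y t :: real assume "t \<in> {0..}"
  then show "\<bar>right (0, y) t\<bar> \<le> 1 \<and> \<bar>dot {0..} (right (0, y)) t\<bar> \<le> 1 \<and>
      (right (0, y) t \<noteq> c \<longrightarrow> \<bar>dot {0..} (dot {0..} (right (0, y))) t\<bar> \<le> 1)"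
    by (intro C1_solution_bounds[OF right_solution(1)[OF abs_0_le_eps_bound]])
      (auto simp: right_range a_range at_within_half_line_neq_bot
        right_solution(2)[OF abs_0_le_eps_bound] right_vel_le)
qed

lemma bounded_glued:
  assumes "\<And>\<epsilon>. \<epsilon> \<in> I \<Longrightarrow> \<bar>\<epsilon>\<bar> \<le> eps_bound"
    and "\<And>\<epsilon>. \<epsilon> \<in> I \<Longrightarrow> left_vel (\<epsilon>, y \<epsilon>) 0 = right_vel (\<epsilon>, y \<epsilon>) 0"
  shows "bounded_with_derivs c UNIV I (\<lambda>t \<epsilon>. glued (\<epsilon>, y \<epsilon>) t)"
  unfolding bounded_with_derivs_def
proof (intro exI[of _ 1] ballI)
  fix \<epsilon> t :: real assume e: "\<epsilon> \<in> I"
  note sol = glued_solution[OF assms[OF e]]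
  have "0 \<le> glued (\<epsilon>, y \<epsilon>) t" "glued (\<epsilon>, y \<epsilon>) t \<le> 1" "\<bar>glued_vel (\<epsilon>, y \<epsilon>) t\<bar> \<le> 1"
    by (auto simp: glued_def glued_vel_def left_range right_range left_vel_le right_vel_le)
  then show "\<bar>glued (\<epsilon>, y \<epsilon>) t\<bar> \<le> 1 \<and> \<bar>dot UNIV (glued (\<epsilon>, y \<epsilon>)) t\<bar> \<le> 1 \<and>
      (glued (\<epsilon>, y \<epsilon>) t \<noteq> c \<longrightarrow> \<bar>dot UNIV (dot UNIV (glued (\<epsilon>, y \<epsilon>))) t\<bar> \<le> 1)"
    by (intro C1_solution_bounds[OF sol(1)]) (auto simp: a_range sol(2))
qed

lemma uniform_limit_right: "uniform_limit UNIV (\<lambda>t y. right (0, y) t) (\<lambda>_. 1) at_top"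
proof (rule uniform_limitI)
  fix \<delta> :: real assume d: "0 < \<delta>"
  have "\<forall>\<^sub>F t in at_top. exp (- (P.rate_min * t)) < \<delta>" by (rule exp_decay_at_top[OF P.rate_min(1) d])
  moreover have "\<forall>\<^sub>F t in at_top. (0 :: real) \<le> t" by (rule eventually_ge_at_top)
  ultimately show "\<forall>\<^sub>F t in at_top. \<forall>y\<in>UNIV. dist (right (0, y) t) 1 < \<delta>"
  proof eventually_elim
    case (elim t)
    have "dist (right (0, y) t) 1 < \<delta>" for y
      using P.sol_pos[of "(0, y)" t] P.sol_decay[OF elim(2), of "(0, y)"] elim(1)
      by (simp add: right_def dist_real_def)
    then show ?case by blast
  qed
qed

lemma uniform_limit_left: "uniform_limit UNIV (\<lambda>t y. left (0, y) t) (\<lambda>_. 0) at_bot"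
proof (rule uniform_limitI)
  fix \<delta> :: real assume d: "0 < \<delta>"
  have "\<forall>\<^sub>F s in at_top. exp (- (M.rate_min * s)) < \<delta>" by (rule exp_decay_at_top[OF M.rate_min(1) d])
  then have "\<forall>\<^sub>F t in at_bot. exp (- (M.rate_min * - t)) < \<delta>"
    by (rule eventually_compose_filterlim[OF _ filterlim_uminus_at_top_at_bot])
  moreover have "\<forall>\<^sub>F t in at_bot. t \<le> (0 :: real)" by (rule eventually_le_at_bot)
  ultimately show "\<forall>\<^sub>F t in at_bot. \<forall>y\<in>UNIV. dist (left (0, y) t) 0 < \<delta>"
  proof eventually_elim
    case (elim t)
    have "dist (left (0, y) t) 0 < \<delta>" for y
      using M.sol_pos[of "(0, y)" "- t"] M.sol_decay[of "- t" "(0, y)"] elim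
      by (simp add: left_def dist_real_def)
    then show ?case by blast
  qed
qed

lemma left_tracking:
  assumes "(ybar \<longlongrightarrow> y0) (at_right 0)" "0 < \<delta>"
  shows "\<forall>\<^sub>F \<epsilon> in at_right 0. \<forall>t\<in>{..0}. \<bar>left (\<epsilon>, ybar \<epsilon>) t - left (0, \<epsilon> * t + ybar \<epsilon>) t\<bar> \<le> \<delta>"
    and "\<forall>\<^sub>F \<epsilon> in at_right 0. \<forall>t\<in>{..0}. \<bar>left_vel (\<epsilon>, ybar \<epsilon>) t - left_vel (0, \<epsilon> * t + ybar \<epsilon>) t\<bar> \<le> \<delta>"
proof -
  have "\<forall>\<^sub>F e in at_right 0. \<forall>s\<ge>0. \<bar>M.sol (- 1 * e, ybar e) s - M.sol (0, - 1 * e * s + ybar e) s\<bar> \<le> \<delta>"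
    using M.sol_decay M.sol_pos
    by (intro slow_modulation[OF M.jointly_continuous_sol M.rate_min(1) _ assms(1) _ assms(2)]) (auto simp: less_imp_le)
  then show "\<forall>\<^sub>F \<epsilon> in at_right 0. \<forall>t\<in>{..0}. \<bar>left (\<epsilon>, ybar \<epsilon>) t - left (0, \<epsilon> * t + ybar \<epsilon>) t\<bar> \<le> \<delta>"
  proof eventually_elim
    case (elim \<epsilon>)
    show ?case
      using elim[rule_format, of "- t" for t] by (auto simp: left_def)
  qed
  have "\<forall>\<^sub>F e in at_right 0. \<forall>s\<ge>0. \<bar>M.vel (- 1 * e, ybar e) s - M.vel (0, - 1 * e * s + ybar e) s\<bar> \<le> \<delta>"
    using M.vel_decay
    by (intro slow_modulation[OF M.jointly_continuous_vel M.rate_min(1) _ assms(1) _ assms(2)]) auto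
  then show "\<forall>\<^sub>F \<epsilon> in at_right 0. \<forall>t\<in>{..0}. \<bar>left_vel (\<epsilon>, ybar \<epsilon>) t - left_vel (0, \<epsilon> * t + ybar \<epsilon>) t\<bar> \<le> \<delta>"
  proof eventually_elim
    case (elim \<epsilon>)
    show ?case
      using elim[rule_format, of "- t" for t] by (auto simp: left_vel_def abs_minus_commute)
  qed
qed

lemma right_tracking:
  assumes "(ybar \<longlongrightarrow> y0) (at_right 0)" "0 < \<delta>"
  shows "\<forall>\<^sub>F \<epsilon> in at_right 0. \<forall>t\<in>{0..}. \<bar>right (\<epsilon>, ybar \<epsilon>) t - right (0, \<epsilon> * t + ybar \<epsilon>) t\<bar> \<le> \<delta>"
    and "\<forall>\<^sub>F \<epsilon> in at_right 0. \<forall>t\<in>{0..}. \<bar>right_vel (\<epsilon>, ybar \<epsilon>) t - right_vel (0, \<epsilon> * t + ybar \<epsilon>) t\<bar> \<le> \<delta>"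
proof -
  have "\<forall>\<^sub>F e in at_right 0. \<forall>s\<ge>0. \<bar>P.sol (1 * e, ybar e) s - P.sol (0, 1 * e * s + ybar e) s\<bar> \<le> \<delta>"
    using P.sol_decay P.sol_pos
    by (intro slow_modulation[OF P.jointly_continuous_sol P.rate_min(1) _ assms(1) _ assms(2)]) (auto simp: less_imp_le)
  then show "\<forall>\<^sub>F \<epsilon> in at_right 0. \<forall>t\<in>{0..}. \<bar>right (\<epsilon>, ybar \<epsilon>) t - right (0, \<epsilon> * t + ybar \<epsilon>) t\<bar> \<le> \<delta>"
    by eventually_elim (auto simp: right_def abs_minus_commute)
  have "\<forall>\<^sub>F e in at_right 0. \<forall>s\<ge>0. \<bar>P.vel (1 * e, ybar e) s - P.vel (0, 1 * e * s + ybar e) s\<bar> \<le> \<delta>"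
    using P.vel_decay
    by (intro slow_modulation[OF P.jointly_continuous_vel P.rate_min(1) _ assms(1) _ assms(2)]) auto
  then show "\<forall>\<^sub>F \<epsilon> in at_right 0. \<forall>t\<in>{0..}. \<bar>right_vel (\<epsilon>, ybar \<epsilon>) t - right_vel (0, \<epsilon> * t + ybar \<epsilon>) t\<bar> \<le> \<delta>"
    by eventually_elim (auto simp: right_vel_def abs_minus_commute)
qed

lemma D_fun_deriv:
  "(D_fun c am ap has_real_derivative deriv (D_fun c am ap) y) (at y)"
proof -
  have "(D_fun c am ap has_real_derivative c\<^sup>2 * (2 * c - 3) * (ap' y - am' y) + ap' y) (at y)"
    unfolding D_fun_def[abs_def]
    by (rule derivative_eq_intros am(1) ap(1) refl | simp)+
  then show ?thesis by (simp add: DERIV_imp_deriv)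
qed

lemma slopes_agree_at_eps_0:
  assumes "D_fun c am ap y0 = 0"
  shows "dot {..0} (left (0, y0)) 0 = dot {0..} (right (0, y0)) 0"
  using assms gap_0_iff[of "(0, y0)"] abs_0_le_eps_bound
  by (simp add: gap_at_eps_0 left_solution(2) right_solution(2))

lemma modulated_connection:
  assumes zero: "D_fun c am ap y0 = 0" and simple: "deriv (D_fun c am ap) y0 \<noteq> 0"
  shows "\<exists>\<epsilon>0>0. \<exists>ybar. ybar C1_differentiable_on {0<..<\<epsilon>0} \<and> (ybar \<longlongrightarrow> y0) (at_right 0) \<and>
    (\<forall>\<epsilon>\<in>{0<..<\<epsilon>0}. \<bar>\<epsilon>\<bar> \<le> eps_bound \<and> left_vel (\<epsilon>, ybar \<epsilon>) 0 = right_vel (\<epsilon>, ybar \<epsilon>) 0)"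
proof -
  obtain \<alpha> \<beta> where chords: "continuous_on UNIV \<alpha>" "continuous_on UNIV \<beta>"
    "\<And>p' p. \<bar>fst p'\<bar> \<le> eps_bound \<Longrightarrow> \<bar>fst p\<bar> \<le> eps_bound \<Longrightarrow>
      gap p' - gap p = \<alpha> (p', p) * (snd p' - snd p) + \<beta> (p', p) * (fst p' - fst p)"
    by (rule gap_chords) blast
  have "((\<lambda>y. gap (0, y)) has_real_derivative - deriv (D_fun c am ap) y0 / 3) (at y0)"
    unfolding gap_at_eps_0 by (intro DERIV_cdivide DERIV_minus D_fun_deriv)
  from chord_implicit_function[OF chords(1,2) eps_bound(1) chords(3) _ this]
  obtain e0 ybar where "0 < e0" "e0 \<le> eps_bound" "ybar C1_differentiable_on {0<..<e0}"
    "(ybar \<longlongrightarrow> y0) (at_right 0)" "\<forall>e\<in>{0<..<e0}. gap (e, ybar e) = 0"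
    using zero simple by (auto simp: gap_at_eps_0)
  then show ?thesis
    by (intro exI[of _ e0] conjI exI[of _ ybar]) (auto simp: gap_0_iff)
qed

end

theorem proposition7p5:
  fixes am ap :: "real \<Rightarrow> real" and c :: real
  assumes "am C1_differentiable_on UNIV" and "ap C1_differentiable_on UNIV"
    and "bounded (range (deriv am))" and "bounded (range (deriv ap))"
    and "0 < (INF y. am y)" and "0 < (INF y. ap y)"
    and "(SUP y. am y) < 1" and "(SUP y. ap y) < 1"
    and "\<And>y. 0 < ap y" and "\<And>y. ap y < (SUP z. ap z)"
    and "(SUP z. ap z) \<le> 1/2" and "1/2 \<le> (INF z. am z)"
    and "\<And>y. (INF z. am z) < am y" and "\<And>y. am y < 1"
    and "0 < c" and "c < 1"
  shows "\<exists>um up :: real \<Rightarrow> real \<Rightarrow> real.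
    (\<forall>y. C1_solution c am ap 0 y {..0} (\<lambda>t. um t y)) \<and>
    (\<forall>y. C1_solution c am ap 0 y {0..} (\<lambda>t. up t y)) \<and>
    bounded_with_derivs c {..0} UNIV um \<and>
    bounded_with_derivs c {0..} UNIV up \<and>
    (\<forall>y. um 0 y = c \<and> up 0 y = c) \<and>
    uniform_limit UNIV um (\<lambda>y. 0) at_bot \<and>
    uniform_limit UNIV up (\<lambda>y. 1) at_top \<and>
    (\<forall>y0. D_fun c am ap y0 = 0 \<and> deriv (D_fun c am ap) y0 \<noteq> 0 \<longrightarrow>
      dot {..0} (\<lambda>t. um t y0) 0 = dot {0..} (\<lambda>t. up t y0) 0 \<and>
      (\<exists>\<epsilon>0>0. \<exists>(ybar :: real \<Rightarrow> real) (u :: real \<Rightarrow> real \<Rightarrow> real).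
        ybar C1_differentiable_on {0<..<\<epsilon>0} \<and>
        (ybar \<longlongrightarrow> y0) (at_right 0) \<and>
        (\<forall>\<epsilon>\<in>{0<..<\<epsilon>0}. C1_solution c am ap \<epsilon> (ybar \<epsilon>) UNIV (\<lambda>t. u t \<epsilon>)) \<and>
        bounded_with_derivs c UNIV {0<..<\<epsilon>0} u \<and>
        ((\<lambda>\<epsilon>. SUP t\<in>{..0}. \<bar>u t \<epsilon> - um t (\<epsilon> * t + ybar \<epsilon>)\<bar>) \<longlongrightarrow> 0) (at_right 0) \<and>
        ((\<lambda>\<epsilon>. SUP t\<in>{0..}. \<bar>u t \<epsilon> - up t (\<epsilon> * t + ybar \<epsilon>)\<bar>) \<longlongrightarrow> 0) (at_right 0) \<and>
        ((\<lambda>\<epsilon>. SUP t\<in>{..0}. \<bar>dot UNIV (\<lambda>s. u s \<epsilon>) t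
            - dot {..0} (\<lambda>s. um s (\<epsilon> * t + ybar \<epsilon>)) t\<bar>) \<longlongrightarrow> 0) (at_right 0) \<and>
        ((\<lambda>\<epsilon>. SUP t\<in>{0..}. \<bar>dot UNIV (\<lambda>s. u s \<epsilon>) t
            - dot {0..} (\<lambda>s. up s (\<epsilon> * t + ybar \<epsilon>)) t\<bar>) \<longlongrightarrow> 0) (at_right 0)))"
proof -
  obtain L1 L2 where L: "\<And>y. \<bar>deriv am y\<bar> \<le> L1" "\<And>y. \<bar>deriv ap y\<bar> \<le> L2"
    using assms(3,4) unfolding bounded_iff by (auto simp: image_iff)
  have Lm: "\<bar>deriv am y\<bar> \<le> max L1 L2" "\<bar>deriv ap y\<bar> \<le> max L1 L2" for y
    using L(1)[of y] L(2)[of y] by auto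
  have am_range: "1 / 2 \<le> am y" "am y \<le> 1" for y
    using assms(12) assms(13)[of y] assms(14)[of y] by linarith+
  have ap_range: "0 \<le> ap y" "ap y \<le> 1 / 2" for y
    using assms(11) assms(9)[of y] assms(10)[of y] by linarith+
  interpret switched_reaction am "deriv am" ap "deriv ap" c "max L1 L2"
  proof
    show "0 \<le> max L1 L2" using Lm(1)[of 0] by linarith
  qed (use assms C1_differentiable_on_UNIV_deriv Lm am_range ap_range in auto)
  note e0 = abs_0_le_eps_bound
  have persist: "\<exists>\<epsilon>0>0. \<exists>ybar (u :: real \<Rightarrow> real \<Rightarrow> real).
        ybar C1_differentiable_on {0<..<\<epsilon>0} \<and>
        (ybar \<longlongrightarrow> y0) (at_right 0) \<and>
        (\<forall>\<epsilon>\<in>{0<..<\<epsilon>0}. C1_solution c am ap \<epsilon> (ybar \<epsilon>) UNIV (\<lambda>t. u t \<epsilon>)) \<and>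
        bounded_with_derivs c UNIV {0<..<\<epsilon>0} u \<and>
        ((\<lambda>\<epsilon>. SUP t\<in>{..0}. \<bar>u t \<epsilon> - left (0, \<epsilon> * t + ybar \<epsilon>) t\<bar>) \<longlongrightarrow> 0) (at_right 0) \<and>
        ((\<lambda>\<epsilon>. SUP t\<in>{0..}. \<bar>u t \<epsilon> - right (0, \<epsilon> * t + ybar \<epsilon>) t\<bar>) \<longlongrightarrow> 0) (at_right 0) \<and>
        ((\<lambda>\<epsilon>. SUP t\<in>{..0}. \<bar>dot UNIV (\<lambda>s. u s \<epsilon>) t
            - dot {..0} (left (0, \<epsilon> * t + ybar \<epsilon>)) t\<bar>) \<longlongrightarrow> 0) (at_right 0) \<and>
        ((\<lambda>\<epsilon>. SUP t\<in>{0..}. \<bar>dot UNIV (\<lambda>s. u s \<epsilon>) t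
            - dot {0..} (right (0, \<epsilon> * t + ybar \<epsilon>)) t\<bar>) \<longlongrightarrow> 0) (at_right 0)"
    if D: "D_fun c am ap y0 = 0" "deriv (D_fun c am ap) y0 \<noteq> 0" for y0
  proof -
    obtain \<epsilon>0 ybar where y: "0 < \<epsilon>0" "ybar C1_differentiable_on {0<..<\<epsilon>0}" "(ybar \<longlongrightarrow> y0) (at_right 0)"
      and m: "\<And>\<epsilon>. \<epsilon> \<in> {0<..<\<epsilon>0} \<Longrightarrow> \<bar>\<epsilon>\<bar> \<le> eps_bound"
        "\<And>\<epsilon>. \<epsilon> \<in> {0<..<\<epsilon>0} \<Longrightarrow> left_vel (\<epsilon>, ybar \<epsilon>) 0 = right_vel (\<epsilon>, ybar \<epsilon>) 0"
      using modulated_connection[OF D] by blast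
    note sol = glued_solution[OF m]
    have ev: "\<forall>\<^sub>F \<epsilon> in at_right 0. \<epsilon> \<in> {0<..<\<epsilon>0}" by (rule eventually_at_right_real[OF y(1)])
    have gr: "glued p t = right p t" if "0 \<le> t" for p t
      using that by (cases "t = 0") (auto simp: glued_def left_0 right_0)
    have gvr: "glued_vel (\<epsilon>, ybar \<epsilon>) t = right_vel (\<epsilon>, ybar \<epsilon>) t" if "0 \<le> t" "\<epsilon> \<in> {0<..<\<epsilon>0}" for \<epsilon> t
      using that m(2) by (cases "t = 0") (auto simp: glued_vel_def)
    have "((\<lambda>\<epsilon>. SUP t\<in>{..0}. \<bar>glued (\<epsilon>, ybar \<epsilon>) t - left (0, \<epsilon> * t + ybar \<epsilon>) t\<bar>) \<longlongrightarrow> 0) (at_right 0)"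
      by (rule SUP_abs_tendsto_0, force) (use left_tracking(1)[OF y(3)] in \<open>simp add: glued_def\<close>)
    moreover have "((\<lambda>\<epsilon>. SUP t\<in>{0..}. \<bar>glued (\<epsilon>, ybar \<epsilon>) t - right (0, \<epsilon> * t + ybar \<epsilon>) t\<bar>) \<longlongrightarrow> 0) (at_right 0)"
      by (rule SUP_abs_tendsto_0, force) (use right_tracking(1)[OF y(3)] in \<open>simp add: gr\<close>)
    moreover have "((\<lambda>\<epsilon>. SUP t\<in>{..0}. \<bar>dot UNIV (glued (\<epsilon>, ybar \<epsilon>)) t
            - dot {..0} (left (0, \<epsilon> * t + ybar \<epsilon>)) t\<bar>) \<longlongrightarrow> 0) (at_right 0)"
    proof (rule SUP_abs_tendsto_0)
      fix \<delta> :: real assume "0 < \<delta>"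
      from left_tracking(2)[OF y(3) this] ev
      show "\<forall>\<^sub>F \<epsilon> in at_right 0. \<forall>t\<in>{..0}. \<bar>dot UNIV (glued (\<epsilon>, ybar \<epsilon>)) t - dot {..0} (left (0, \<epsilon> * t + ybar \<epsilon>)) t\<bar> \<le> \<delta>"
        by eventually_elim (simp add: sol(2) left_solution(2)[OF e0] glued_vel_def)
    qed simp
    moreover have "((\<lambda>\<epsilon>. SUP t\<in>{0..}. \<bar>dot UNIV (glued (\<epsilon>, ybar \<epsilon>)) t
            - dot {0..} (right (0, \<epsilon> * t + ybar \<epsilon>)) t\<bar>) \<longlongrightarrow> 0) (at_right 0)"
    proof (rule SUP_abs_tendsto_0)
      fix \<delta> :: real assume "0 < \<delta>"
      from right_tracking(2)[OF y(3) this] ev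
      show "\<forall>\<^sub>F \<epsilon> in at_right 0. \<forall>t\<in>{0..}. \<bar>dot UNIV (glued (\<epsilon>, ybar \<epsilon>)) t - dot {0..} (right (0, \<epsilon> * t + ybar \<epsilon>)) t\<bar> \<le> \<delta>"
        by eventually_elim (simp add: sol(2) right_solution(2)[OF e0] gvr)
    qed simp
    moreover have "bounded_with_derivs c UNIV {0<..<\<epsilon>0} (\<lambda>t \<epsilon>. glued (\<epsilon>, ybar \<epsilon>) t)"
      by (rule bounded_glued[OF m])
    ultimately show ?thesis
      using y sol(1) by (intro exI[of _ \<epsilon>0] conjI exI[of _ ybar] exI[of _ "\<lambda>t \<epsilon>. glued (\<epsilon>, ybar \<epsilon>) t"]) auto
  qed
  show ?thesis
    using left_solution(1)[OF e0] right_solution(1)[OF e0] bounded_left bounded_right left_0 right_0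
      uniform_limit_left uniform_limit_right slopes_agree_at_eps_0 persist
    by (intro exI[of _ "\<lambda>t y. left (0, y) t"] exI[of _ "\<lambda>t y. right (0, y) t"] conjI allI impI) auto
qed

end
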